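(* Let $(t,w(\cdot))\in\mathcal{G}$ and $\theta\in[t,T]$. Then $$\rho_-(t,w(\cdot))=\inf_{\boldsymbol{a}\in\boldsymbol{\mathcal{A}}[t,T]}\ \sup_{v(\cdot)\in\mathcal{V}[t,T]}\Bigl(\rho_-(\theta,x_\theta(\cdot))+\int_t^\theta\chi\bigl(\tau,x(\tau),\boldsymbol{a}[v(\cdot)](\tau),v(\tau)\bigr)\,d\tau\Bigr),$$ where $x(\cdot)=x(\cdot;t,w(\cdot),\boldsymbol{a}[v(\cdot)](\cdot),v(\cdot))$, and, analogously, $$\rho_+(t,w(\cdot))=\sup_{\boldsymbol{b}\in\boldsymbol{\mathcal{B}}[t,T]}\ \inf_{u(\cdot)\in\mathcal{U}[t,T]}\Bigl(\rho_+(\theta,x_\theta(\cdot))+\int_t^\theta\chi\bigl(\tau,x(\tau),u(\tau),\boldsymbol{b}[u(\cdot)](\tau)\bigr)\,d\tau\Bigr),$$ where $x(\cdot)=x(\cdot;t,w(\cdot),u(\cdot),\boldsymbol{b}[u(\cdot)](\cdot))$.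
   Context: Data and standing assumptions. $n\in\mathbb{N}$, $T>0$; $\|\cdot\|$ is the Euclidean norm on $\mathbb{R}^n$ and the induced norm on $\mathbb{R}^{n\times n}$; $B(R)$ is the closed ball of radius $R$ centered at $0$; $\Omega=\{(\tau,\xi)\in[0,T]^2:\tau\ge\xi\}$, $\Omega^\circ=\{(\tau,\xi)\in\Omega:\tau>\xi\}$. $P\subset\mathbb{R}^{n_P}$, $Q\subset\mathbb{R}^{n_Q}$ are nonempty compact sets; $y(\cdot)\in C([0,T],\mathbb{R}^n)$ is fixed. (1) $f:[0,T]\times\mathbb{R}^n\times P\times Q\to\mathbb{R}^n$ is continuous; for every $R>0$ there is $\lambda>0$ with $\|f(\tau,x,u,v)-f(\tau,x',u,v)\|\le\lambda\|x-x'\|$ for all $\tau\in[0,T]$, $x,x'\in B(R)$, $u\in P$, $v\in Q$; there is $c>0$ with $\|f(\tau,x,u,v)\|\le c(1+\|x\|)$ for all arguments. (2) $K:\Omega^\circ\to\mathbb{R}^{n\times n}$, $K(\tau,\xi)=K_*(\tau,\xi)/(\tau-\xi)^{1-\alpha}$ with $\alpha\in(0,1)$ and continuous $K_*:\Omega\to\mathbb{R}^{n\times n}$ for which there are $\beta\in(0,1]$, $\lambda>0$ with $\|K_*(\tau,\xi)-K_*(\tau,\xi')\|\le\lambda|\xi-\xi'|^\beta$ for all $(\tau,\xi),(\tau,\xi')\in\Omega$. (3) For every $t\in(0,T]$, if $\ell\in L_\infty([0,t],\mathbb{R}^n)$ and $\int_0^\tau K(\tau,\xi)\ell(\xi)\,d\xi=0$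 for all $\tau\in[0,t]$, then $\ell=0$ a.e. on $[0,t]$. (4) $\chi:[0,T]\times\mathbb{R}^n\times P\times Q\to\mathbb{R}$ is continuous; for every $R>0$ there is $\lambda>0$ with $|\chi(\tau,x,u,v)-\chi(\tau,x',u,v)|\le\lambda\|x-x'\|$ for all $\tau\in[0,T]$, $x,x'\in B(R)$, $u\in P$, $v\in Q$; $\sigma:C([0,T],\mathbb{R}^n)\to\mathbb{R}$ is such that for every compact $\mathcal{D}\subset C([0,T],\mathbb{R}^n)$ there is $\lambda>0$ with $|\sigma(x)-\sigma(x')|\le\lambda(\|x(T)-x'(T)\|+\int_0^T\|x(\tau)-x'(\tau)\|\,d\tau)$ for all $x,x'\in\mathcal{D}$. Positions. $x_t(\cdot)$ denotes the restriction of $x$ to $[0,t]$. For $t\in(0,T]$, $\mathcal{W}[0,t]$ is the set of $w:[0,t]\to\mathbb{R}^n$ for which there is $\ell(\cdot)\in L_\infty([0,t],\mathbb{R}^n)$ with $w(\tau)=y(\tau)+\int_0^\tau K(\tau,\xi)\ell(\xi)\,d\xi$ for all $\tau\in[0,t]$; by (3) $\ell$ is unique (a.e.), denoted $\ell(\cdot;t,w(\cdot))$. $\mathcal{W}[0,0]$ consists of the single function $w$ with $w(0)=y(0)$, and $\ell(0;0,w(\cdot)):=0$. $\mathcal{G}=\bigcup_{t\in[0,T]}(\{t\}\times\mathcal{W}[0,t])$. $a(\tau;t,w(\cdot))=w(\tau)$ for $\tau\in[0,t)$ and $a(\tau;t,w(\cdot))=y(\tau)+\int_0^tK(\tau,\xi)\ell(\xi;t,w(\cdot))\,d\xi$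 for $\tau\in[t,T]$. Game. For $(t,w(\cdot))\in\mathcal{G}$, $\mathcal{U}[t,T]$ and $\mathcal{V}[t,T]$ are the sets of Lebesgue measurable $u:[t,T]\to P$ and $v:[t,T]\to Q$. The motion $x(\cdot;t,w(\cdot),u(\cdot),v(\cdot))$ is the unique $x(\cdot)\in C([0,T],\mathbb{R}^n)$ with $x_t(\cdot)=w(\cdot)$ and $x(\tau)=a(\tau;t,w(\cdot))+\int_t^\tau K(\tau,\xi)f(\xi,x(\xi),u(\xi),v(\xi))\,d\xi$ for $\tau\in[t,T]$ (then $(\theta,x_\theta(\cdot))\in\mathcal{G}$ for all $\theta$). The cost is $J(t,w(\cdot),u(\cdot),v(\cdot))=\sigma(x(\cdot))+\int_t^T\chi(\tau,x(\tau),u(\tau),v(\tau))\,d\tau$ along this motion. $\boldsymbol{\mathcal{A}}[t,T]$ is the set of maps $\boldsymbol{a}:\mathcal{V}[t,T]\to\mathcal{U}[t,T]$ such that for every $\theta\in[t,T]$, if $v=v'$ a.e. on $[t,\theta]$ then $\boldsymbol{a}[v]=\boldsymbol{a}[v']$ a.e. on $[t,\theta]$; $\boldsymbol{\mathcal{B}}[t,T]$ is the analogous set of maps $\boldsymbol{b}:\mathcal{U}[t,T]\to\mathcal{V}[t,T]$. The lower and upper value functionals are $\rho_-(t,w(\cdot))=\inf_{\boldsymbol{a}\in\boldsymbol{\mathcal{A}}[t,T]}\sup_{v\in\mathcal{V}[t,T]}J(t,w(\cdot),\boldsymbol{a}[v](\cdot),v(\cdot))$, $\rho_+(t,w(\cdot))=\sup_{\boldsymbol{b}\in\boldsymbol{\mathcal{B}}[t,T]}\inf_{u\in\mathcal{U}[t,T]}J(t,w(\cdot),u(\cdot),\boldsymbol{b}[u](\cdot))$.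 *)

theory Defs
  imports "HOL-Analysis.Analysis"
begin

text \<open>
  A function on an interval \<open>[0,t]\<close> or \<open>[t,T]\<close> is represented by a total function on the reals that
  is extensional on that interval, so that equality of such functions is equality of the values
  there. In particular the restriction \<open>x\<^sub>t\<close> is \<open>restrict x {0..t}\<close>. Only data that are merely
  evaluated (\<open>y\<close>, \<open>f\<close>, \<open>K\<close>, \<open>chi\<close>) and representatives of elements of \<open>L\<^sub>\<infinity>\<close> are left as
  arbitrary total functions.
\<close>

definition Omega :: "real \<Rightarrow> (real \<times> real) set" where
  "Omega T = {(\<tau>, \<xi>). \<tau> \<in> {0..T} \<and> \<xi> \<in> {0..T} \<and> \<tau> \<ge> \<xi>}"

definition Omega_open :: "real \<Rightarrow> (real \<times> real) set" where
  "Omega_open T = {(\<tau>, \<xi>). (\<tau>, \<xi>) \<in> Omega T \<and> \<tau> > \<xi>}"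

definition C_space :: "real \<Rightarrow> (real \<Rightarrow> real^'n) metric" where
  "C_space T = cfunspace (top_of_set {0..T}) euclidean_metric"

text \<open>The library's norm on \<open>real^'n^'n\<close> is not the operator norm.\<close>

definition mat_norm :: "real^'n^'n \<Rightarrow> real" where
  "mat_norm A = onorm ((*v) A)"

definition L_infty :: "real \<Rightarrow> (real \<Rightarrow> real^'n) set" where
  "L_infty t = {l. l \<in> borel_measurable (lebesgue_on {0..t}) \<and>
                   (\<exists>C. AE \<xi> in lebesgue_on {0..t}. norm (l \<xi>) \<le> C)}"


subsection \<open>Positions\<close>

definition generates ::
  "(real \<Rightarrow> real^'n) \<Rightarrow> (real \<Rightarrow> real \<Rightarrow> real^'n^'n) \<Rightarrow> real \<Rightarrow>
     (real \<Rightarrow> real^'n) \<Rightarrow> (real \<Rightarrow> real^'n) \<Rightarrow> bool" where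
  "generates y K t l w \<longleftrightarrow> l \<in> L_infty t \<and>
     (\<forall>\<tau>\<in>{0..t}. w \<tau> = y \<tau> + (LINT \<xi>:{0..\<tau>}|lebesgue. K \<tau> \<xi> *v l \<xi>))"

definition histories ::
  "(real \<Rightarrow> real^'n) \<Rightarrow> (real \<Rightarrow> real \<Rightarrow> real^'n^'n) \<Rightarrow> real \<Rightarrow> (real \<Rightarrow> real^'n) set" where
  "histories y K t =
     (if t = 0 then {w \<in> extensional {0..0}. w 0 = y 0}
      else {w \<in> extensional {0..t}. \<exists>l. generates y K t l w})"

definition positions ::
  "real \<Rightarrow> (real \<Rightarrow> real^'n) \<Rightarrow> (real \<Rightarrow> real \<Rightarrow> real^'n^'n) \<Rightarrow> (real \<times> (real \<Rightarrow> real^'n)) set" where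
  "positions T y K = (SIGMA t:{0..T}. histories y K t)"

text \<open>
  The density \<open>\<ell>(\<cdot>;t,w)\<close> is determined only up to a null set; \<open>SOME\<close> picks a representative, and
  the density is used below only under an integral.
\<close>

definition gen_density ::
  "(real \<Rightarrow> real^'n) \<Rightarrow> (real \<Rightarrow> real \<Rightarrow> real^'n^'n) \<Rightarrow> real \<Rightarrow> (real \<Rightarrow> real^'n) \<Rightarrow> real \<Rightarrow> real^'n" where
  "gen_density y K t w = (if t = 0 then (\<lambda>\<xi>. 0) else (SOME l. generates y K t l w))"

definition extension ::
  "(real \<Rightarrow> real^'n) \<Rightarrow> (real \<Rightarrow> real \<Rightarrow> real^'n^'n) \<Rightarrow> real \<Rightarrow> (real \<Rightarrow> real^'n) \<Rightarrow> real \<Rightarrow> real^'n" where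
  "extension y K t w \<tau> =
     (if \<tau> < t then w \<tau> else y \<tau> + (LINT \<xi>:{0..t}|lebesgue. K \<tau> \<xi> *v gen_density y K t w \<xi>))"


subsection \<open>The game\<close>

definition controls :: "real \<Rightarrow> real \<Rightarrow> (real^'m) set \<Rightarrow> (real \<Rightarrow> real^'m) set" where
  "controls t T S = {u \<in> {t..T} \<rightarrow>\<^sub>E S. u \<in> borel_measurable (lebesgue_on {t..T})}"

definition motion ::
  "real \<Rightarrow> (real \<Rightarrow> real^'n) \<Rightarrow> (real \<Rightarrow> real \<Rightarrow> real^'n^'n) \<Rightarrow>
     (real \<Rightarrow> real^'n \<Rightarrow> real^'p \<Rightarrow> real^'q \<Rightarrow> real^'n) \<Rightarrow>
     real \<Rightarrow> (real \<Rightarrow> real^'n) \<Rightarrow> (real \<Rightarrow> real^'p) \<Rightarrow> (real \<Rightarrow> real^'q) \<Rightarrow> real \<Rightarrow> real^'n" where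
  "motion T y K f t w u v =
     (THE x. x \<in> mspace (C_space T) \<and> restrict x {0..t} = w \<and>
        (\<forall>\<tau>\<in>{t..T}. x \<tau> = extension y K t w \<tau> +
           (LINT \<xi>:{t..\<tau>}|lebesgue. K \<tau> \<xi> *v f \<xi> (x \<xi>) (u \<xi>) (v \<xi>))))"

definition cost ::
  "real \<Rightarrow> (real \<Rightarrow> real^'n) \<Rightarrow> (real \<Rightarrow> real \<Rightarrow> real^'n^'n) \<Rightarrow>
     (real \<Rightarrow> real^'n \<Rightarrow> real^'p \<Rightarrow> real^'q \<Rightarrow> real^'n) \<Rightarrow>
     (real \<Rightarrow> real^'n \<Rightarrow> real^'p \<Rightarrow> real^'q \<Rightarrow> real) \<Rightarrow> ((real \<Rightarrow> real^'n) \<Rightarrow> real) \<Rightarrow>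
     real \<Rightarrow> (real \<Rightarrow> real^'n) \<Rightarrow> (real \<Rightarrow> real^'p) \<Rightarrow> (real \<Rightarrow> real^'q) \<Rightarrow> real" where
  "cost T y K f chi \<sigma> t w u v =
     (let x = motion T y K f t w u v
      in \<sigma> x + (LINT \<tau>:{t..T}|lebesgue. chi \<tau> (x \<tau>) (u \<tau>) (v \<tau>)))"

text \<open>
  Non-anticipative strategies on \<open>[t,T]\<close> answering opponent controls with values in \<open>S\<close> by own
  controls with values in \<open>S'\<close>.
\<close>

definition strategies ::
  "real \<Rightarrow> real \<Rightarrow> (real^'m) set \<Rightarrow> (real^'k) set \<Rightarrow> ((real \<Rightarrow> real^'m) \<Rightarrow> real \<Rightarrow> real^'k) set" where
  "strategies t T S S' =
     {a \<in> controls t T S \<rightarrow>\<^sub>E controls t T S'.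
        \<forall>\<theta>\<in>{t..T}. \<forall>v\<in>controls t T S. \<forall>v'\<in>controls t T S.
          (AE \<tau> in lebesgue_on {t..\<theta>}. v \<tau> = v' \<tau>) \<longrightarrow>
          (AE \<tau> in lebesgue_on {t..\<theta>}. a v \<tau> = a v' \<tau>)}"

text \<open>
  On the reals, \<open>Inf\<close> and \<open>Sup\<close> of an unbounded set are unspecified. The values are therefore
  extended reals; they are finite when the data satisfy the standing assumptions of the game.
\<close>

definition lower_value ::
  "real \<Rightarrow> (real^'p) set \<Rightarrow> (real^'q) set \<Rightarrow>
     (real \<Rightarrow> real^'n) \<Rightarrow> (real \<Rightarrow> real \<Rightarrow> real^'n^'n) \<Rightarrow>
     (real \<Rightarrow> real^'n \<Rightarrow> real^'p \<Rightarrow> real^'q \<Rightarrow> real^'n) \<Rightarrow>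
     (real \<Rightarrow> real^'n \<Rightarrow> real^'p \<Rightarrow> real^'q \<Rightarrow> real) \<Rightarrow> ((real \<Rightarrow> real^'n) \<Rightarrow> real) \<Rightarrow>
     real \<Rightarrow> (real \<Rightarrow> real^'n) \<Rightarrow> ereal" where
  "lower_value T P Q y K f chi \<sigma> t w =
     (INF a\<in>strategies t T Q P. SUP v\<in>controls t T Q.
        ereal (cost T y K f chi \<sigma> t w (a v) v))"

definition upper_value ::
  "real \<Rightarrow> (real^'p) set \<Rightarrow> (real^'q) set \<Rightarrow>
     (real \<Rightarrow> real^'n) \<Rightarrow> (real \<Rightarrow> real \<Rightarrow> real^'n^'n) \<Rightarrow>
     (real \<Rightarrow> real^'n \<Rightarrow> real^'p \<Rightarrow> real^'q \<Rightarrow> real^'n) \<Rightarrow>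
     (real \<Rightarrow> real^'n \<Rightarrow> real^'p \<Rightarrow> real^'q \<Rightarrow> real) \<Rightarrow> ((real \<Rightarrow> real^'n) \<Rightarrow> real) \<Rightarrow>
     real \<Rightarrow> (real \<Rightarrow> real^'n) \<Rightarrow> ereal" where
  "upper_value T P Q y K f chi \<sigma> t w =
     (SUP b\<in>strategies t T P Q. INF u\<in>controls t T P.
        ereal (cost T y K f chi \<sigma> t w u (b u)))"

end

theory Submission
  imports Defs
begin

text \<open>
  The game part is the classical concatenation argument for non-anticipative strategies; the analysis
  of the integral equation supplies the two facts on which it rests: the cost splits at time \<open>\<theta>\<close>
  (\<open>cost_split\<close>), and what has happened up to \<open>\<theta>\<close> depends on the controls only through their values
  almost everywhere on \<open>[t,\<theta>]\<close> (\<open>motion_AE_cong\<close>, \<open>running_cost_AE_cong\<close>).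

  \<^item> Let \<open>l\<close> be the density of the initial history. A continuous \<open>x\<close> is the motion if and only if
    \<open>x(\<tau>) = y(\<tau>) + \<integral>\<^sub>0\<^sup>\<tau> K(\<tau>,\<xi>) L(\<xi>) d\<xi>\<close> on all of \<open>[0,T]\<close>, where \<open>L = l\<close> before \<open>t\<close> and
    \<open>L(\<xi>) = f(\<xi>, x(\<xi>), u(\<xi>), v(\<xi>))\<close> afterwards (\<open>motion_equation_iff_solves\<close>). In the norm weighted by
    \<open>e\<^sup>-\<^sup>\<kappa>\<^sup>\<tau>\<close> with large \<open>\<kappa>\<close> the Volterra operator is small (\<open>volterra_weighted_bound\<close>), which gives a
    Gronwall inequality and, by a fixed point argument, existence and uniqueness of motions
    (\<open>volterra_equation_has_solution\<close>, \<open>solves_unique\<close>). Uniqueness on \<open>[0,\<theta>]\<close> shows that \<open>x\<^sub>\<theta>\<close> depends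
    only on the classes of the controls modulo equality almost everywhere on \<open>[t,\<theta>]\<close>.

  \<^item> The history \<open>x\<^sub>\<theta>\<close> is generated by \<open>L\<close> on \<open>[0,\<theta>]\<close>, and by injectivity of the kernel operator
    up to null sets by no other density. The equation that characterizes the motion issuing from \<open>(\<theta>, x\<^sub>\<theta>)\<close> is therefore
    again the equation of \<open>x\<close> (\<open>motion_semigroup\<close>), and the cost splits.

  \<^item> For ``\<open>\<le>\<close>'', a strategy is followed up to \<open>\<theta>\<close> and then replaced by a nearly optimal
    strategy for the position reached; the replacement is selected by the history and the cost accrued
    so far, so the composite is non-anticipative (\<open>continued_strategy\<close>). For ``\<open>\<ge>\<close>'', a strategy on
    \<open>[t,T]\<close> and a control \<open>v\<close> induce a strategy on \<open>[\<theta>,T]\<close>, namely its answer to controls that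
    coincide with \<open>v\<close> before \<open>\<theta>\<close> (\<open>tail_strategy\<close>), and these controls are among those over which the
    supremum is taken.

  \<^item> The statement for the upper value is the one for the lower value of the game in which the
    players have exchanged roles and the cost has changed sign.
\<close>


section \<open>Lebesgue integrals on intervals\<close>

lemma AE_lebesgue_on_interval_iff:
  fixes a b :: real
  shows "(AE \<xi> in lebesgue_on {a..b}. R \<xi>) \<longleftrightarrow> (AE \<xi> in lebesgue. \<xi> \<in> {a..b} \<longrightarrow> R \<xi>)"
  by (rule AE_restrict_space_iff) simp

lemma AE_lebesgue_on_subinterval:
  fixes a b c d :: real
  assumes "AE \<xi> in lebesgue_on {a..b}. R \<xi>" and "{c..d} \<subseteq> {a..b}"
  shows "AE \<xi> in lebesgue_on {c..d}. R \<xi>"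
  using assms unfolding AE_lebesgue_on_interval_iff by (auto elim!: eventually_mono)

lemma AE_lebesgue_neq: "AE \<xi> in lebesgue. \<xi> \<noteq> (c::real)"
  by (rule AE_completion) (rule AE_lborel_singleton)

lemma AE_lebesgue_on_neq: "AE \<xi> in lebesgue_on {a..b}. \<xi> \<noteq> (c::real)"
  using AE_lebesgue_neq[of c] unfolding AE_lebesgue_on_interval_iff by (auto elim!: eventually_mono)

lemma set_integral_eq_lebesgue_on:
  fixes g :: "real \<Rightarrow> 'b::{banach, second_countable_topology}"
  shows "(LINT \<xi>:{a..b}|lebesgue. g \<xi>) = (LINT \<xi>|lebesgue_on {a..b}. g \<xi>)"
  unfolding set_lebesgue_integral_def by (rule integral_restrict_space[symmetric]) simp

lemma borel_measurable_lebesgue_on_subinterval: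
  fixes g :: "real \<Rightarrow> 'b::topological_space"
  assumes "g \<in> borel_measurable (lebesgue_on {a..b})" and "{c..d} \<subseteq> {a..b}"
  shows "g \<in> borel_measurable (lebesgue_on {c..d})"
  using assms by (rule measurable_restrict_mono)

lemma continuous_on_imp_borel_measurable_lebesgue_on:
  fixes g :: "real \<Rightarrow> 'b::topological_space"
  assumes "continuous_on {a..b} g"
  shows "g \<in> borel_measurable (lebesgue_on {a..b})"
proof -
  have "g \<in> borel_measurable (restrict_space borel {a..b})"
    using assms by (rule borel_measurable_continuous_on_restrict)
  moreover have "(\<lambda>x. x) \<in> measurable (lebesgue_on {a..b}) (restrict_space borel {a..b})"
    by (rule measurable_restrict_space3) (auto intro: measurable_completion)
  ultimately show ?thesis
    using measurable_compose by fastforce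
qed

lemma set_integrable_interval_iff:
  fixes g :: "real \<Rightarrow> 'b::{banach, second_countable_topology}"
  shows "set_integrable lebesgue {a..b} g \<longleftrightarrow> integrable (lebesgue_on {a..b}) g"
  unfolding set_integrable_def by (rule integrable_restrict_space[symmetric]) simp

lemma set_integral_interval_split:
  fixes g :: "real \<Rightarrow> 'b::{banach, second_countable_topology}"
  assumes "set_integrable lebesgue {a..c} g" and "a \<le> b" and "b \<le> c"
  shows "(LINT \<xi>:{a..c}|lebesgue. g \<xi>) = (LINT \<xi>:{a..b}|lebesgue. g \<xi>) + (LINT \<xi>:{b..c}|lebesgue. g \<xi>)"
proof -
  have "(LINT \<xi>:{a..b} \<union> {b..c}|lebesgue. g \<xi>)
      = (LINT \<xi>:{a..b}|lebesgue. g \<xi>) + (LINT \<xi>:{b..c}|lebesgue. g \<xi>)"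
  proof (rule set_integral_Un_AE)
    show "AE x in lebesgue. \<not> (x \<in> {a..b} \<and> x \<in> {b..c})"
      using AE_lebesgue_neq[of b] by eventually_elim auto
    show "set_integrable lebesgue {a..b} g" "set_integrable lebesgue {b..c} g"
      using assms by (auto intro: set_integrable_subset)
  qed auto
  moreover have "{a..b} \<union> {b..c} = {a..c}" using assms by auto
  ultimately show ?thesis by simp
qed

lemma set_integral_cong_except_right_endpoint:
  fixes g h :: "real \<Rightarrow> 'b::{banach, second_countable_topology}"
  assumes "\<And>\<xi>. \<xi> \<in> {a..<b} \<Longrightarrow> g \<xi> = h \<xi>"
  shows "(LINT \<xi>:{a..b}|lebesgue. g \<xi>) = (LINT \<xi>:{a..b}|lebesgue. h \<xi>)"
proof -
  have *: "(LINT \<xi>:{a..b}|lebesgue. k \<xi>) = (LINT \<xi>:{a..<b}|lebesgue. k \<xi>)" for k :: "real \<Rightarrow> 'b"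
    by (rule set_integral_discrete_difference[where X = "{b}"]) auto
  show ?thesis unfolding * using assms by (intro set_lebesgue_integral_cong) auto
qed

lemma continuous_matrix_vector_mult_pair:
  "continuous_on UNIV (\<lambda>z. fst z *v (snd z :: real^'n) :: real^'m)"
  unfolding matrix_vector_mult_def by (intro continuous_intros continuous_on_vec_lambda)

lemma borel_measurable_matrix_vector_mult:
  fixes A :: "'a \<Rightarrow> real^'n^'m"
  assumes "A \<in> borel_measurable M" "g \<in> borel_measurable M"
  shows "(\<lambda>x. A x *v g x) \<in> borel_measurable M"
  using assms continuous_matrix_vector_mult_pair by (rule borel_measurable_continuous_Pair)


section \<open>Essentially bounded densities\<close>

lemma L_infty_mono:
  assumes "l \<in> L_infty b" and "a \<le> b"
  shows "l \<in> L_infty a"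
  using assms borel_measurable_lebesgue_on_subinterval[where a=0 and b=b and c=0 and d=a]
    AE_lebesgue_on_subinterval[where a=0 and b=b and c=0 and d=a]
  unfolding L_infty_def by fastforce

lemma L_infty_diff:
  assumes "l \<in> L_infty a" and "l' \<in> L_infty a"
  shows "(\<lambda>\<xi>. l \<xi> - l' \<xi>) \<in> L_infty a"
proof -
  obtain C C' where "AE \<xi> in lebesgue_on {0..a}. norm (l \<xi>) \<le> C"
    and "AE \<xi> in lebesgue_on {0..a}. norm (l' \<xi>) \<le> C'"
    using assms unfolding L_infty_def by auto
  then have "AE \<xi> in lebesgue_on {0..a}. norm (l \<xi> - l' \<xi>) \<le> C + C'"
    by eventually_elim (smt (verit) norm_triangle_ineq4)
  then show ?thesis
    using assms unfolding L_infty_def by auto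
qed

text \<open>Gluing a density at time \<open>t\<close>.\<close>

lemma L_infty_if_less:
  assumes "l \<in> L_infty t" and "m \<in> borel_measurable (lebesgue_on {t..b})" and "t \<le> b" and "0 \<le> t"
    and "\<And>\<xi>. \<xi> \<in> {t..b} \<Longrightarrow> norm (m \<xi>) \<le> D"
  shows "(\<lambda>\<xi>. if \<xi> < t then l \<xi> else m \<xi>) \<in> L_infty b"
proof -
  obtain C where l: "l \<in> borel_measurable (lebesgue_on {0..t})"
    and C: "AE \<xi> in lebesgue_on {0..t}. norm (l \<xi>) \<le> C"
    using assms unfolding L_infty_def by auto
  let ?l = "\<lambda>\<xi>. if \<xi> \<in> {0..t} then l \<xi> else 0"
  let ?m = "\<lambda>\<xi>. if \<xi> \<in> {t..b} then m \<xi> else 0"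
  have [measurable]: "?l \<in> borel_measurable lebesgue" "?m \<in> borel_measurable lebesgue"
    using l assms by (auto intro!: borel_measurable_if[THEN iffD2] simp del: atLeastAtMost_iff)
  have "(\<lambda>\<xi>. if \<xi> < t then ?l \<xi> else ?m \<xi>) \<in> borel_measurable lebesgue"
  proof (rule measurable_If)
    show "{x \<in> space lebesgue. x < t} \<in> sets lebesgue"
      by (simp add: lessThan_def[symmetric])
  qed fact+
  then have "(\<lambda>\<xi>. if \<xi> < t then ?l \<xi> else ?m \<xi>) \<in> borel_measurable (lebesgue_on {0..b})"
    by (rule measurable_restrict_space1)
  then have meas: "(\<lambda>\<xi>. if \<xi> < t then l \<xi> else m \<xi>) \<in> borel_measurable (lebesgue_on {0..b})"
    by (rule iffD1[OF measurable_lebesgue_cong, rotated]) auto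
  have "AE \<xi> in lebesgue_on {0..b}. norm (if \<xi> < t then l \<xi> else m \<xi>) \<le> max C D"
    using C assms unfolding AE_lebesgue_on_interval_iff
    by (force elim!: eventually_mono simp: le_max_iff_disj)
  with meas show ?thesis unfolding L_infty_def by blast
qed

lemma continuous_on_imp_L_infty:
  assumes "continuous_on {0..a} l"
  shows "l \<in> L_infty a"
proof -
  have "bounded (l ` {0..a})"
    using assms by (intro compact_imp_bounded compact_continuous_image) auto
  then obtain C where "\<And>\<xi>. \<xi> \<in> {0..a} \<Longrightarrow> norm (l \<xi>) \<le> C"
    unfolding bounded_iff by blast
  then have "AE \<xi> in lebesgue_on {0..a}. norm (l \<xi>) \<le> C"
    unfolding AE_lebesgue_on_interval_iff by auto
  then show ?thesis
    using continuous_on_imp_borel_measurable_lebesgue_on[OF assms] unfolding L_infty_def by blast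
qed


lemma L_infty_restrict:
  assumes "l \<in> L_infty a" and "A \<in> sets lebesgue"
  shows "(\<lambda>\<xi>. if \<xi> \<in> A then l \<xi> else 0) \<in> L_infty a"
proof -
  obtain C where l: "l \<in> borel_measurable (lebesgue_on {0..a})"
    and C: "AE \<xi> in lebesgue_on {0..a}. norm (l \<xi>) \<le> C"
    using assms unfolding L_infty_def by auto
  have "(\<lambda>\<xi>. if \<xi> \<in> A then l \<xi> else 0) \<in> borel_measurable (lebesgue_on {0..a})"
  proof (rule measurable_If)
    have "{x \<in> space (lebesgue_on {0..a}). x \<in> A} = {0..a} \<inter> A"
      by auto
    then show "{x \<in> space (lebesgue_on {0..a}). x \<in> A} \<in> sets (lebesgue_on {0..a})"
      using assms by (auto simp: sets_restrict_space)
  qed (use l in auto)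
  moreover have "AE \<xi> in lebesgue_on {0..a}. norm (if \<xi> \<in> A then l \<xi> else 0) \<le> max C 0"
    using C by eventually_elim auto
  ultimately show ?thesis unfolding L_infty_def by blast
qed

lemma L_inftyI_bounded:
  assumes "l \<in> borel_measurable (lebesgue_on {0..a})" and "\<And>\<xi>. \<xi> \<in> {0..a} \<Longrightarrow> norm (l \<xi>) \<le> C"
  shows "l \<in> L_infty a"
proof -
  have "AE \<xi> in lebesgue_on {0..a}. norm (l \<xi>) \<le> C"
    using assms(2) unfolding AE_lebesgue_on_interval_iff by auto
  then show ?thesis using assms(1) unfolding L_infty_def by blast
qed


section \<open>The weakly singular kernel\<close>

lemma Abel_kernel_integral:
  fixes a \<tau> \<gamma> :: real
  assumes "0 < \<gamma>" and "a \<le> \<tau>"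
  shows "integrable (lebesgue_on {a..\<tau>}) (\<lambda>\<xi>. (\<tau> - \<xi>) powr (\<gamma> - 1))"
    and "(LINT \<xi>|lebesgue_on {a..\<tau>}. (\<tau> - \<xi>) powr (\<gamma> - 1)) = (\<tau> - a) powr \<gamma> / \<gamma>"
proof -
  let ?F = "\<lambda>\<xi>. - ((\<tau> - \<xi>) powr \<gamma> / \<gamma>)"
  have "((\<lambda>\<xi>. (\<tau> - \<xi>) powr (\<gamma> - 1)) has_integral (?F \<tau> - ?F a)) {a..\<tau>}"
  proof (rule fundamental_theorem_of_calculus_interior)
    show "continuous_on {a..\<tau>} ?F"
      using assms by (intro continuous_intros continuous_on_powr') auto
    fix x assume "x \<in> {a<..<\<tau>}"
    then have "(?F has_real_derivative (\<tau> - x) powr (\<gamma> - 1)) (at x)"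
      using assms by (auto intro!: derivative_eq_intros)
    then show "(?F has_vector_derivative (\<tau> - x) powr (\<gamma> - 1)) (at x)"
      by (simp add: has_real_derivative_iff_has_vector_derivative)
  qed fact
  then have *: "((\<lambda>\<xi>. (\<tau> - \<xi>) powr (\<gamma> - 1)) has_integral (\<tau> - a) powr \<gamma> / \<gamma>) {a..\<tau>}"
    using assms by simp
  then have "set_integrable lebesgue {a..\<tau>} (\<lambda>\<xi>. (\<tau> - \<xi>) powr (\<gamma> - 1))"
    by (intro nonnegative_absolutely_integrable_1) (auto simp: integrable_on_def)
  then show i: "integrable (lebesgue_on {a..\<tau>}) (\<lambda>\<xi>. (\<tau> - \<xi>) powr (\<gamma> - 1))"
    unfolding set_integrable_def by (subst integrable_restrict_space) auto
  show "(LINT \<xi>|lebesgue_on {a..\<tau>}. (\<tau> - \<xi>) powr (\<gamma> - 1)) = (\<tau> - a) powr \<gamma> / \<gamma>"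
    using lebesgue_integral_eq_integral[OF i] * by (simp add: integral_unique)
qed

text \<open>
  Exponential damping turns part of the singular power into a small factor: \<open>e\<^sup>-\<^sup>s \<le> s\<^sup>-\<^sup>\<gamma>\<close> for \<open>s > 0\<close>
  and \<open>\<gamma> \<in> [0,1]\<close>.
\<close>

lemma exp_minus_le_powr_minus:
  fixes s \<gamma> :: real
  assumes "0 < s" "0 \<le> \<gamma>" "\<gamma> \<le> 1"
  shows "exp (- s) \<le> s powr (- \<gamma>)"
proof -
  have "s powr \<gamma> \<le> exp s"
  proof (cases "s \<le> 1")
    case True
    then have "s powr \<gamma> \<le> 1" using assms by (simp add: powr_le1)
    also have "1 \<le> exp s" using assms by simp
    finally show ?thesis .
  next
    case False
    then have "s powr \<gamma> \<le> s powr 1" using assms by (intro powr_mono) auto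
    also have "\<dots> \<le> exp s" using assms exp_ge_add_one_self[of s] by (simp del: exp_ge_add_one_self)
    finally show ?thesis .
  qed
  then show ?thesis
    using assms by (simp add: powr_minus exp_minus le_imp_inverse_le)
qed

text \<open>The Volterra integral operator with kernel \<open>K\<close>, evaluated at time \<open>\<tau>\<close>.\<close>

definition volterra :: "(real \<Rightarrow> real \<Rightarrow> real^'n^'n) \<Rightarrow> real \<Rightarrow> (real \<Rightarrow> real^'n) \<Rightarrow> real^'n" where
  "volterra K \<tau> l = (LINT \<xi>:{0..\<tau>}|lebesgue. K \<tau> \<xi> *v l \<xi>)"

lemma volterra_cong:
  assumes "\<And>\<xi>. \<xi> \<in> {0..\<tau>} \<Longrightarrow> l \<xi> = l' \<xi>"
  shows "volterra K \<tau> l = volterra K \<tau> l'"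
  unfolding volterra_def using assms by (intro set_lebesgue_integral_cong) auto

text \<open>
  The kernel itself is prescribed only below the diagonal; its values on the diagonal do not influence
  any integral.
\<close>

locale weakly_singular_kernel =
  fixes T \<alpha> :: real and K Kstar :: "real \<Rightarrow> real \<Rightarrow> real^'n^'n"
  assumes T_pos: "T > 0"
    and \<alpha>: "0 < \<alpha>" "\<alpha> < 1"
    and K_eq: "\<forall>(\<tau>, \<xi>)\<in>Omega_open T. K \<tau> \<xi> = (1 / (\<tau> - \<xi>) powr (1 - \<alpha>)) *\<^sub>R Kstar \<tau> \<xi>"
    and Kstar_cont: "continuous_on (Omega T) (\<lambda>(\<tau>, \<xi>). Kstar \<tau> \<xi>)"
begin

lemma K_mult:
  assumes "0 \<le> \<xi>" "\<xi> < \<tau>" "\<tau> \<le> T"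
  shows "K \<tau> \<xi> *v z = (\<tau> - \<xi>) powr (\<alpha> - 1) *\<^sub>R (Kstar \<tau> \<xi> *v z)"
proof -
  have "(\<tau>, \<xi>) \<in> Omega_open T"
    using assms by (auto simp: Omega_open_def Omega_def)
  then have "K \<tau> \<xi> = (\<tau> - \<xi>) powr (\<alpha> - 1) *\<^sub>R Kstar \<tau> \<xi>"
    using K_eq powr_minus_divide[of "\<tau> - \<xi>" "1 - \<alpha>"] by auto
  then show ?thesis
    by (simp add: scaleR_matrix_vector_assoc)
qed

lemma Kstar_bounded:
  obtains M where "M > 0"
    and "\<And>\<tau> \<xi> z. (\<tau>, \<xi>) \<in> Omega T \<Longrightarrow> norm (Kstar \<tau> \<xi> *v z) \<le> M * norm z"
proof -
  have "Omega T = ({0..T} \<times> {0..T}) \<inter> {p. snd p \<le> fst p}"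
    by (auto simp: Omega_def)
  moreover have "closed {p::real \<times> real. snd p \<le> fst p}"
    by (intro closed_Collect_le continuous_intros)
  ultimately have "compact (Omega T)"
    by (simp add: compact_Int_closed compact_Times)
  moreover have "continuous_on (Omega T) (\<lambda>p. \<Sum>i\<in>UNIV. \<Sum>j\<in>UNIV. \<bar>Kstar (fst p) (snd p) $ i $ j\<bar>)"
    using Kstar_cont unfolding split_beta by (intro continuous_intros)
  ultimately have "bounded ((\<lambda>p. \<Sum>i\<in>UNIV. \<Sum>j\<in>UNIV. \<bar>Kstar (fst p) (snd p) $ i $ j\<bar>) ` Omega T)"
    by (intro compact_imp_bounded compact_continuous_image)
  then obtain M where M: "M > 0"
    "\<And>p. p \<in> Omega T \<Longrightarrow> (\<Sum>i\<in>UNIV. \<Sum>j\<in>UNIV. \<bar>Kstar (fst p) (snd p) $ i $ j\<bar>) \<le> M"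
    unfolding bounded_pos by fastforce
  have "norm (Kstar \<tau> \<xi> *v z) \<le> M * norm z" if "(\<tau>, \<xi>) \<in> Omega T" for \<tau> \<xi> z
  proof -
    have "norm (Kstar \<tau> \<xi> *v z) \<le> onorm ((*v) (Kstar \<tau> \<xi>)) * norm z"
      by (intro onorm matrix_vector_mul_bounded_linear)
    also have "\<dots> \<le> M * norm z"
      using onorm_le_matrix_component_sum[of "Kstar \<tau> \<xi>"] M(2)[OF that]
      by (intro mult_right_mono) auto
    finally show ?thesis .
  qed
  with M(1) show thesis by (rule that)
qed

lemma borel_measurable_K_mult:
  assumes "\<tau> \<in> {0..T}" and "l \<in> borel_measurable (lebesgue_on {0..\<tau>})"
  shows "(\<lambda>\<xi>. K \<tau> \<xi> *v l \<xi>) \<in> borel_measurable (lebesgue_on {0..\<tau>})"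
proof -
  have "continuous_on {0..\<tau>} (\<lambda>\<xi>. (\<lambda>(\<tau>, \<xi>). Kstar \<tau> \<xi>) (\<tau>, \<xi>))"
    by (rule continuous_on_compose2[OF Kstar_cont])
       (use assms in \<open>auto intro!: continuous_intros simp: Omega_def\<close>)
  then have "Kstar \<tau> \<in> borel_measurable (lebesgue_on {0..\<tau>})"
    by (intro continuous_on_imp_borel_measurable_lebesgue_on) simp
  then have [measurable]: "(\<lambda>\<xi>. Kstar \<tau> \<xi> *v l \<xi>) \<in> borel_measurable (lebesgue_on {0..\<tau>})"
    using assms by (intro borel_measurable_matrix_vector_mult)
  have [measurable]: "(\<lambda>\<xi>. (\<tau> - \<xi>) powr (\<alpha> - 1)) \<in> borel_measurable (lebesgue_on {0..\<tau>})"
    using Abel_kernel_integral(1)[of \<alpha> 0 \<tau>] assms \<alpha> by auto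
  let ?g = "\<lambda>\<xi>. (\<tau> - \<xi>) powr (\<alpha> - 1) *\<^sub>R (Kstar \<tau> \<xi> *v l \<xi>)"
  have [measurable]: "{\<tau>} \<in> sets (lebesgue_on {0..\<tau>})"
    using assms by (auto simp: sets_restrict_space image_iff intro!: bexI[of _ "{\<tau>}"])
  have "(\<lambda>\<xi>. if \<xi> \<in> {\<tau>} then K \<tau> \<tau> *v l \<tau> else ?g \<xi>) \<in> borel_measurable (lebesgue_on {0..\<tau>})"
    by measurable
  then show ?thesis
    by (rule iffD1[OF measurable_lebesgue_cong, rotated]) (use assms K_mult in auto)
qed

lemma norm_K_mult_le:
  assumes M: "M > 0" "\<And>\<tau> \<xi> z. (\<tau>, \<xi>) \<in> Omega T \<Longrightarrow> norm (Kstar \<tau> \<xi> *v z) \<le> M * norm z"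
    and "0 \<le> \<xi>" "\<xi> < \<tau>" "\<tau> \<le> T" "norm z \<le> r"
  shows "norm (K \<tau> \<xi> *v z) \<le> M * ((\<tau> - \<xi>) powr (\<alpha> - 1) * r)"
proof -
  have "norm (K \<tau> \<xi> *v z) = (\<tau> - \<xi>) powr (\<alpha> - 1) * norm (Kstar \<tau> \<xi> *v z)"
    using assms by (simp add: K_mult)
  also have "\<dots> \<le> (\<tau> - \<xi>) powr (\<alpha> - 1) * (M * r)"
    using M(1) M(2)[of \<tau> \<xi> z] assms(3-) 
    by (intro mult_left_mono) (auto simp: Omega_def intro: order_trans mult_left_mono)
  finally show ?thesis by (simp add: algebra_simps)
qed

lemma integrable_K_mult:
  assumes "\<tau> \<in> {0..T}" and "l \<in> L_infty \<tau>"
  shows "integrable (lebesgue_on {0..\<tau>}) (\<lambda>\<xi>. K \<tau> \<xi> *v l \<xi>)"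
proof -
  obtain M where M: "M > 0"
    "\<And>\<tau> \<xi> z. (\<tau>, \<xi>) \<in> Omega T \<Longrightarrow> norm (Kstar \<tau> \<xi> *v z) \<le> M * norm z"
    using Kstar_bounded by blast
  obtain C where l: "l \<in> borel_measurable (lebesgue_on {0..\<tau>})"
    and C: "AE \<xi> in lebesgue_on {0..\<tau>}. norm (l \<xi>) \<le> C"
    using assms unfolding L_infty_def by auto
  show ?thesis
  proof (rule Bochner_Integration.integrable_bound)
    show "integrable (lebesgue_on {0..\<tau>}) (\<lambda>\<xi>. M * ((\<tau> - \<xi>) powr (\<alpha> - 1) * C))"
      using Abel_kernel_integral(1)[of \<alpha> 0 \<tau>] assms \<alpha> by auto
    show "(\<lambda>\<xi>. K \<tau> \<xi> *v l \<xi>) \<in> borel_measurable (lebesgue_on {0..\<tau>})"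
      using assms(1) l by (rule borel_measurable_K_mult)
    show "AE \<xi> in lebesgue_on {0..\<tau>}. norm (K \<tau> \<xi> *v l \<xi>) \<le> norm (M * ((\<tau> - \<xi>) powr (\<alpha> - 1) * C))"
      using C AE_lebesgue_on_neq[where a=0 and b=\<tau> and c=\<tau>] AE_space
    proof eventually_elim
      case (elim \<xi>)
      then have "norm (K \<tau> \<xi> *v l \<xi>) \<le> M * ((\<tau> - \<xi>) powr (\<alpha> - 1) * C)"
        using assms by (intro norm_K_mult_le[OF M]) auto
      then show ?case by simp
    qed
  qed
qed

lemma volterra_diff:
  assumes "\<tau> \<in> {0..T}" and "l \<in> L_infty \<tau>" and "l' \<in> L_infty \<tau>"
  shows "volterra K \<tau> (\<lambda>\<xi>. l \<xi> - l' \<xi>) = volterra K \<tau> l - volterra K \<tau> l'"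
  unfolding volterra_def set_integral_eq_lebesgue_on
  using integrable_K_mult[OF assms(1,2)] integrable_K_mult[OF assms(1,3)]
  by (simp add: matrix_vector_mult_diff_distrib)

lemma volterra_cong_AE:
  assumes "\<tau> \<in> {0..T}" and "l \<in> L_infty \<tau>" and "l' \<in> L_infty \<tau>"
    and "AE \<xi> in lebesgue_on {0..\<tau>}. l \<xi> = l' \<xi>"
  shows "volterra K \<tau> l = volterra K \<tau> l'"
  unfolding volterra_def set_integral_eq_lebesgue_on
  using integrable_K_mult[OF assms(1,2)] integrable_K_mult[OF assms(1,3)] assms(4)
  by (intro integral_cong_AE) (auto elim!: eventually_mono)

lemma norm_volterra_le:
  assumes M: "M > 0" "\<And>\<tau> \<xi> z. (\<tau>, \<xi>) \<in> Omega T \<Longrightarrow> norm (Kstar \<tau> \<xi> *v z) \<le> M * norm z"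
    and "\<tau> \<in> {0..T}" and "l \<in> L_infty \<tau>"
    and bound: "AE \<xi> in lebesgue_on {0..\<tau>}. \<xi> < \<tau> \<longrightarrow> (\<tau> - \<xi>) powr (\<alpha> - 1) * norm (l \<xi>) \<le> \<phi> \<xi>"
    and int: "integrable (lebesgue_on {0..\<tau>}) \<phi>"
  shows "norm (volterra K \<tau> l) \<le> M * (LINT \<xi>|lebesgue_on {0..\<tau>}. \<phi> \<xi>)"
proof -
  have "norm (volterra K \<tau> l) \<le> (LINT \<xi>|lebesgue_on {0..\<tau>}. norm (K \<tau> \<xi> *v l \<xi>))"
    unfolding volterra_def set_integral_eq_lebesgue_on by (rule integral_norm_bound)
  also have "\<dots> \<le> (LINT \<xi>|lebesgue_on {0..\<tau>}. M * \<phi> \<xi>)"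
  proof (rule integral_mono_AE)
    show "AE \<xi> in lebesgue_on {0..\<tau>}. norm (K \<tau> \<xi> *v l \<xi>) \<le> M * \<phi> \<xi>"
      using bound AE_lebesgue_on_neq[where a=0 and b=\<tau> and c=\<tau>] AE_space
    proof eventually_elim
      case (elim \<xi>)
      then have "norm (K \<tau> \<xi> *v l \<xi>) \<le> M * ((\<tau> - \<xi>) powr (\<alpha> - 1) * norm (l \<xi>))"
        using assms(3) by (intro norm_K_mult_le[OF M]) auto
      also have "\<dots> \<le> M * \<phi> \<xi>"
        using elim M(1) by (intro mult_left_mono) auto
      finally show ?case .
    qed
  qed (use int integrable_K_mult[OF assms(3,4)] in auto)
  finally show ?thesis using int by simp
qed

text \<open>
  In the norm weighted by \<open>e\<^sup>-\<^sup>\<kappa>\<^sup>\<tau>\<close> the Volterra operator has arbitrarily small norm once \<open>\<kappa>\<close> is large.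
  Existence, uniqueness and a priori bounds for the motions all rest on this estimate.
\<close>

lemma volterra_weighted_bound:
  assumes "\<epsilon> > 0"
  obtains \<kappa> where "\<kappa> > 0" and "\<And>D \<tau> l. \<lbrakk>0 \<le> D; \<tau> \<in> {0..T}; l \<in> L_infty \<tau>;
      AE \<xi> in lebesgue_on {0..\<tau>}. norm (l \<xi>) \<le> D * exp (\<kappa> * \<xi>)\<rbrakk>
      \<Longrightarrow> norm (volterra K \<tau> l) \<le> \<epsilon> * D * exp (\<kappa> * \<tau>)"
proof -
  obtain M where M: "M > 0"
    "\<And>\<tau> \<xi> z. (\<tau>, \<xi>) \<in> Omega T \<Longrightarrow> norm (Kstar \<tau> \<xi> *v z) \<le> M * norm z"
    using Kstar_bounded by blast
  \<comment> \<open>Half of the exponent is spent on the damping factor, the other half keeps the kernel integrable.\<close>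
  define \<gamma> where "\<gamma> = \<alpha> / 2"
  have \<gamma>: "0 < \<gamma>" "\<gamma> \<le> 1" "\<alpha> = 2 * \<gamma>" using \<alpha> by (auto simp: \<gamma>_def)
  define B where "B = M * (T powr \<gamma> / \<gamma>)"
  have B: "B > 0" using M \<gamma> T_pos by (auto simp: B_def)
  \<comment> \<open>the solution of \<open>\<kappa> powr (- \<gamma>) * B = \<epsilon>\<close>\<close>
  define \<kappa> where "\<kappa> = (\<epsilon> / B) powr (- 1 / \<gamma>)"
  have \<kappa>: "\<kappa> > 0" using B assms by (simp add: \<kappa>_def)
  have \<kappa>\<epsilon>: "\<kappa> powr (- \<gamma>) * B = \<epsilon>"
    using B assms \<gamma> by (simp add: \<kappa>_def powr_powr)
  have "norm (volterra K \<tau> l) \<le> \<epsilon> * D * exp (\<kappa> * \<tau>)"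
    if D: "0 \<le> D" and \<tau>: "\<tau> \<in> {0..T}" and l: "l \<in> L_infty \<tau>"
      and bound: "AE \<xi> in lebesgue_on {0..\<tau>}. norm (l \<xi>) \<le> D * exp (\<kappa> * \<xi>)" for D \<tau> l
  proof -
    let ?c = "\<kappa> powr (- \<gamma>) * D * exp (\<kappa> * \<tau>)"
    have "norm (volterra K \<tau> l)
        \<le> M * (LINT \<xi>|lebesgue_on {0..\<tau>}. ?c * (\<tau> - \<xi>) powr (\<gamma> - 1))"
    proof (rule norm_volterra_le[OF M \<tau> l])
      show "AE \<xi> in lebesgue_on {0..\<tau>}. \<xi> < \<tau> \<longrightarrow>
          (\<tau> - \<xi>) powr (\<alpha> - 1) * norm (l \<xi>) \<le> ?c * (\<tau> - \<xi>) powr (\<gamma> - 1)"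
        using bound
      proof eventually_elim
        case (elim \<xi>)
        show ?case
        proof
          assume less: "\<xi> < \<tau>"
          have "exp (\<kappa> * \<xi>) = exp (- (\<kappa> * (\<tau> - \<xi>))) * exp (\<kappa> * \<tau>)"
            by (simp add: exp_add[symmetric] algebra_simps)
          also have "\<dots> \<le> (\<kappa> * (\<tau> - \<xi>)) powr (- \<gamma>) * exp (\<kappa> * \<tau>)"
            using less \<kappa> \<gamma> by (intro mult_right_mono exp_minus_le_powr_minus) auto
          also have "\<dots> = \<kappa> powr (- \<gamma>) * (\<tau> - \<xi>) powr (- \<gamma>) * exp (\<kappa> * \<tau>)"
            using less \<kappa> by (simp add: powr_mult)
          finally have "norm (l \<xi>) \<le> D * (\<kappa> powr (- \<gamma>) * (\<tau> - \<xi>) powr (- \<gamma>) * exp (\<kappa> * \<tau>))"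
            using elim D by (meson mult_left_mono order_trans)
          then have "(\<tau> - \<xi>) powr (\<alpha> - 1) * norm (l \<xi>)
              \<le> (\<tau> - \<xi>) powr (\<alpha> - 1) * (D * (\<kappa> powr (- \<gamma>) * (\<tau> - \<xi>) powr (- \<gamma>) * exp (\<kappa> * \<tau>)))"
            by (intro mult_left_mono) auto
          also have "\<dots> = ?c * ((\<tau> - \<xi>) powr (\<alpha> - 1) * (\<tau> - \<xi>) powr (- \<gamma>))"
            by (simp add: algebra_simps)
          also have "(\<tau> - \<xi>) powr (\<alpha> - 1) * (\<tau> - \<xi>) powr (- \<gamma>) = (\<tau> - \<xi>) powr (\<gamma> - 1)"
            by (simp add: powr_add[symmetric] \<gamma>)
          finally show "(\<tau> - \<xi>) powr (\<alpha> - 1) * norm (l \<xi>) \<le> ?c * (\<tau> - \<xi>) powr (\<gamma> - 1)" .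
        qed
      qed
      show "integrable (lebesgue_on {0..\<tau>}) (\<lambda>\<xi>. ?c * (\<tau> - \<xi>) powr (\<gamma> - 1))"
        using Abel_kernel_integral(1)[of \<gamma> 0 \<tau>] \<gamma> \<tau> by auto
    qed
    also have "\<dots> = M * (?c * (\<tau> powr \<gamma> / \<gamma>))"
      using Abel_kernel_integral[of \<gamma> 0 \<tau>] \<gamma> \<tau> by simp
    also have "\<dots> \<le> M * (?c * (T powr \<gamma> / \<gamma>))"
      using M \<gamma> \<tau> D by (intro mult_left_mono divide_right_mono powr_mono2) auto
    also have "\<dots> = \<kappa> powr (- \<gamma>) * B * D * exp (\<kappa> * \<tau>)"
      by (simp add: B_def)
    also have "\<dots> = \<epsilon> * D * exp (\<kappa> * \<tau>)"
      by (simp add: \<kappa>\<epsilon>)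
    finally show ?thesis .
  qed
  with \<kappa> show thesis by (rule that)
qed

text \<open>
  Cutting off the singularity at distance \<open>\<delta>\<close> changes the Volterra integral by \<open>O(\<delta>\<^sup>\<alpha>)\<close>, uniformly in
  the time, and the truncated integrals are continuous by dominated convergence.
\<close>

lemma continuous_on_volterra:
  assumes l: "l \<in> L_infty T"
  shows "continuous_on {0..T} (\<lambda>\<tau>. volterra K \<tau> l)"
proof -
  obtain M where M: "M > 0"
    "\<And>\<tau> \<xi> z. (\<tau>, \<xi>) \<in> Omega T \<Longrightarrow> norm (Kstar \<tau> \<xi> *v z) \<le> M * norm z"
    using Kstar_bounded by blast
  obtain C0 where lm: "l \<in> borel_measurable (lebesgue_on {0..T})"
    and C0: "AE \<xi> in lebesgue_on {0..T}. norm (l \<xi>) \<le> C0"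
    using l unfolding L_infty_def by auto
  define C where "C = max C0 0"
  have C: "C \<ge> 0" "AE \<xi> in lebesgue_on {0..T}. norm (l \<xi>) \<le> C"
    using C0 by (auto simp: C_def le_max_iff_disj elim!: eventually_mono)
  have l\<tau>: "l \<in> L_infty \<tau>" if "\<tau> \<in> {0..T}" for \<tau>
    using l that by (auto intro: L_infty_mono)
  have trunc: "(\<lambda>\<xi>. if \<xi> < r then l \<xi> else 0) \<in> L_infty \<tau>" if "\<tau> \<in> {0..T}" for r \<tau>
    using L_infty_restrict[OF l\<tau>[OF that], of "{..<r}"] by simp
  define V where "V \<delta> \<tau> = volterra K \<tau> (\<lambda>\<xi>. if \<xi> < \<tau> - \<delta> then l \<xi> else 0)" for \<delta> \<tau>
  have V_cont: "continuous_on {0..T} (V \<delta>)" if \<delta>: "\<delta> > 0" for \<delta>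
  proof (rule continuous_on_sequentiallyI)
    fix u a assume u: "\<forall>n. u n \<in> {0..T}" and a: "a \<in> {0..T}" and lim: "u \<longlonglongrightarrow> a"
    let ?h = "\<lambda>\<tau> \<xi>. if \<xi> < \<tau> - \<delta> then K \<tau> \<xi> *v l \<xi> else 0"
    have h_eq: "(\<lambda>\<xi>. if \<xi> \<in> {0..\<tau>} then K \<tau> \<xi> *v (if \<xi> < \<tau> - \<delta> then l \<xi> else 0) else 0) \<xi> = ?h \<tau> \<xi>"
      if "\<xi> \<in> {0..T}" for \<tau> \<xi>
      using that \<delta> by auto
    have V_eq: "V \<delta> \<tau> = (LINT \<xi>|lebesgue_on {0..T}. ?h \<tau> \<xi>)" if "\<tau> \<in> {0..T}" for \<tau>
    proof -
      have "V \<delta> \<tau> = (LINT \<xi>|lebesgue_on {0..T}. (if \<xi> \<in> {0..\<tau>} then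
          K \<tau> \<xi> *v (if \<xi> < \<tau> - \<delta> then l \<xi> else 0) else 0))"
        unfolding V_def volterra_def set_integral_eq_lebesgue_on
        using that by (intro integral_restrict[symmetric]) auto
      also have "\<dots> = (LINT \<xi>|lebesgue_on {0..T}. ?h \<tau> \<xi>)"
        by (intro Bochner_Integration.integral_cong) (use \<delta> in auto)
      finally show ?thesis .
    qed
    have meas: "?h \<tau> \<in> borel_measurable (lebesgue_on {0..T})" if "\<tau> \<in> {0..T}" for \<tau>
    proof -
      have "(\<lambda>\<xi>. if \<xi> < \<tau> - \<delta> then l \<xi> else 0) \<in> borel_measurable (lebesgue_on {0..\<tau>})"
        using trunc[OF that] unfolding L_infty_def by blast
      then have "(\<lambda>\<xi>. K \<tau> \<xi> *v (if \<xi> < \<tau> - \<delta> then l \<xi> else 0)) \<in> borel_measurable (lebesgue_on {0..\<tau>})"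
        using that by (intro borel_measurable_K_mult)
      then have "(\<lambda>\<xi>. if \<xi> \<in> {0..\<tau>} then K \<tau> \<xi> *v (if \<xi> < \<tau> - \<delta> then l \<xi> else 0) else 0)
          \<in> borel_measurable (lebesgue_on {0..T})"
        using that by (intro borel_measurable_if_lebesgue_on[THEN iffD2]) auto
      then show ?thesis
        by (rule iffD1[OF measurable_lebesgue_cong, rotated]) (rule h_eq)
    qed
    have "(\<lambda>n. LINT \<xi>|lebesgue_on {0..T}. ?h (u n) \<xi>) \<longlonglongrightarrow> (LINT \<xi>|lebesgue_on {0..T}. ?h a \<xi>)"
    proof (rule integral_dominated_convergence[where w = "\<lambda>_. M * (\<delta> powr (\<alpha> - 1) * C)"])
      show "integrable (lebesgue_on {0..T}) (\<lambda>_. M * (\<delta> powr (\<alpha> - 1) * C))"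
        by (simp add: integrable_restrict_space)
      show "AE \<xi> in lebesgue_on {0..T}. norm (?h (u n) \<xi>) \<le> M * (\<delta> powr (\<alpha> - 1) * C)" for n
        using C(2) AE_space
      proof eventually_elim
        case (elim \<xi>)
        show ?case
        proof (cases "\<xi> < u n - \<delta>")
          case True
          then have "norm (K (u n) \<xi> *v l \<xi>) \<le> M * ((u n - \<xi>) powr (\<alpha> - 1) * C)"
            using elim u \<delta> by (intro norm_K_mult_le[OF M]) auto
          also have "\<dots> \<le> M * (\<delta> powr (\<alpha> - 1) * C)"
            using True \<delta> \<alpha> M(1) C(1) by (intro mult_left_mono mult_right_mono powr_mono2') auto
          finally show ?thesis using True by simp
        qed (use M C in auto)
      qed
      show "AE \<xi> in lebesgue_on {0..T}. (\<lambda>n. ?h (u n) \<xi>) \<longlonglongrightarrow> ?h a \<xi>"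
        using AE_lebesgue_on_neq[where a=0 and b=T and c="a - \<delta>"] AE_space
      proof eventually_elim
        case (elim \<xi>)
        then have \<xi>: "\<xi> \<in> {0..T}" "\<xi> \<noteq> a - \<delta>" by auto
        show ?case
        proof (cases "\<xi> < a - \<delta>")
          case True
          have ev: "\<forall>\<^sub>F n in sequentially. \<xi> < u n - \<delta>"
            using order_tendstoD(1)[OF lim, of "\<xi> + \<delta>"] True by (auto elim: eventually_mono)
          have "((\<lambda>n. (\<lambda>(\<tau>, \<xi>). Kstar \<tau> \<xi>) (u n, \<xi>)) \<longlongrightarrow> (\<lambda>(\<tau>, \<xi>). Kstar \<tau> \<xi>) (a, \<xi>)) sequentially"
            by (rule continuous_on_tendsto_compose[OF Kstar_cont])
               (use True \<xi> a u \<delta> ev in \<open>auto intro!: tendsto_intros lim simp: Omega_def elim: eventually_mono\<close>)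
          then have "(\<lambda>n. Kstar (u n) \<xi> *v l \<xi>) \<longlonglongrightarrow> Kstar a \<xi> *v l \<xi>"
            unfolding matrix_vector_mult_def by (auto intro!: tendsto_intros)
          then have "(\<lambda>n. (u n - \<xi>) powr (\<alpha> - 1) *\<^sub>R (Kstar (u n) \<xi> *v l \<xi>))
              \<longlonglongrightarrow> (a - \<xi>) powr (\<alpha> - 1) *\<^sub>R (Kstar a \<xi> *v l \<xi>)"
            using True \<delta> by (intro tendsto_intros lim) auto
          moreover have "(a - \<xi>) powr (\<alpha> - 1) *\<^sub>R (Kstar a \<xi> *v l \<xi>) = ?h a \<xi>"
            using True \<xi> a \<delta> by (simp add: K_mult)
          moreover have "\<forall>\<^sub>F n in sequentially.
              (u n - \<xi>) powr (\<alpha> - 1) *\<^sub>R (Kstar (u n) \<xi> *v l \<xi>) = ?h (u n) \<xi>"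
            using ev
          proof eventually_elim
            case (elim n)
            then show ?case using \<xi> u[rule_format, of n] \<delta> by (simp add: K_mult)
          qed
          ultimately show ?thesis
            using Lim_transform_eventually by fastforce
        next
          case False
          then have "\<forall>\<^sub>F n in sequentially. u n < \<xi> + \<delta>"
            using order_tendstoD(2)[OF lim, of "\<xi> + \<delta>"] \<xi> by auto
          then have "\<forall>\<^sub>F n in sequentially. 0 = ?h (u n) \<xi>"
            by eventually_elim auto
          then have "(\<lambda>n. ?h (u n) \<xi>) \<longlonglongrightarrow> 0"
            by (rule Lim_transform_eventually[OF tendsto_const])
          then show ?thesis using False by simp
        qed
      qed
    qed (use meas u a in auto)
    then show "(\<lambda>n. V \<delta> (u n)) \<longlonglongrightarrow> V \<delta> a"
      using u a by (simp add: V_eq)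
  qed
  have V_approx: "norm (V \<delta> \<tau> - volterra K \<tau> l) \<le> M * (C * (\<delta> powr \<alpha> / \<alpha>))"
    if \<delta>: "\<delta> > 0" and \<tau>: "\<tau> \<in> {0..T}" for \<delta> \<tau>
  proof -
    let ?k = "\<lambda>\<xi>. (\<tau> - \<xi>) powr (\<alpha> - 1)"
    let ?a = "max 0 (\<tau> - \<delta>)"
    have sub: "{?a..\<tau>} \<subseteq> {0..\<tau>}" by auto
    have int: "integrable (lebesgue_on {?a..\<tau>}) ?k"
      "(LINT \<xi>|lebesgue_on {?a..\<tau>}. ?k \<xi>) = (\<tau> - ?a) powr \<alpha> / \<alpha>"
      using Abel_kernel_integral[of \<alpha> ?a \<tau>] \<alpha> \<delta> \<tau> by auto
    have C\<tau>: "AE \<xi> in lebesgue_on {0..\<tau>}. norm (l \<xi>) \<le> C"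
      by (rule AE_lebesgue_on_subinterval[OF C(2)]) (use \<tau> in auto)
    have diff: "V \<delta> \<tau> - volterra K \<tau> l = volterra K \<tau> (\<lambda>\<xi>. (if \<xi> < \<tau> - \<delta> then l \<xi> else 0) - l \<xi>)"
      unfolding V_def by (rule volterra_diff[symmetric]) (use \<tau> trunc l\<tau> in auto)
    have le: "norm (volterra K \<tau> (\<lambda>\<xi>. (if \<xi> < \<tau> - \<delta> then l \<xi> else 0) - l \<xi>))
        \<le> M * (LINT \<xi>|lebesgue_on {0..\<tau>}. C * (if \<xi> \<in> {?a..\<tau>} then ?k \<xi> else 0))"
    proof (rule norm_volterra_le[OF M \<tau>])
      show "(\<lambda>\<xi>. (if \<xi> < \<tau> - \<delta> then l \<xi> else 0) - l \<xi>) \<in> L_infty \<tau>"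
        using \<tau> trunc l\<tau> by (intro L_infty_diff) auto
      show "AE \<xi> in lebesgue_on {0..\<tau>}. \<xi> < \<tau> \<longrightarrow>
          ?k \<xi> * norm ((if \<xi> < \<tau> - \<delta> then l \<xi> else 0) - l \<xi>) \<le> C * (if \<xi> \<in> {?a..\<tau>} then ?k \<xi> else 0)"
        using C\<tau> AE_space
        by eventually_elim (auto simp: mult.commute[of C] intro: mult_left_mono)
      have "integrable lebesgue (\<lambda>\<xi>. if \<xi> \<in> {?a..\<tau>} then ?k \<xi> else 0)"
        using int(1) by (subst Lebesgue_Measure.integrable_restrict_UNIV) auto
      then have "integrable (lebesgue_on {0..\<tau>}) (\<lambda>\<xi>. if \<xi> \<in> {?a..\<tau>} then ?k \<xi> else 0)"
        by (intro integrable_restrict_space[THEN iffD2] integrable_mult_indicator) auto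
      then show "integrable (lebesgue_on {0..\<tau>}) (\<lambda>\<xi>. C * (if \<xi> \<in> {?a..\<tau>} then ?k \<xi> else 0))"
        by simp
    qed
    have int_eq: "(LINT \<xi>|lebesgue_on {0..\<tau>}. C * (if \<xi> \<in> {?a..\<tau>} then ?k \<xi> else 0))
        = C * ((\<tau> - ?a) powr \<alpha> / \<alpha>)"
      using integral_restrict[OF sub, of ?k] int(2) by simp
    have "M * (C * ((\<tau> - ?a) powr \<alpha> / \<alpha>)) \<le> M * (C * (\<delta> powr \<alpha> / \<alpha>))"
      using M(1) C(1) \<alpha> \<tau> \<delta> by (intro mult_left_mono divide_right_mono powr_mono2) auto
    with le show ?thesis unfolding diff int_eq by (rule order_trans)
  qed
  have "uniform_limit {0..T} (\<lambda>n. V (inverse (real (Suc n)))) (\<lambda>\<tau>. volterra K \<tau> l) sequentially"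
  proof (rule uniform_limitI)
    fix e :: real assume "e > 0"
    have "(\<lambda>n. M * (C * (inverse (real (Suc n)) powr \<alpha> / \<alpha>))) \<longlonglongrightarrow> M * (C * (0 powr \<alpha> / \<alpha>))"
      using \<alpha> by (intro tendsto_intros LIMSEQ_inverse_real_of_nat tendsto_powr') (auto intro!: always_eventually)
    then have "\<forall>\<^sub>F n in sequentially. M * (C * (inverse (real (Suc n)) powr \<alpha> / \<alpha>)) < e"
      using order_tendstoD(2) \<open>e > 0\<close> by fastforce
    then show "\<forall>\<^sub>F n in sequentially. \<forall>\<tau>\<in>{0..T}. dist (V (inverse (real (Suc n))) \<tau>) (volterra K \<tau> l) < e"
    proof eventually_elim
      case (elim n)
      show ?case
        unfolding dist_norm using V_approx[of "inverse (real (Suc n))"] elim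
        by (meson inverse_positive_iff_positive le_less_trans of_nat_0_less_iff zero_less_Suc)
    qed
  qed
  then show ?thesis
    by (rule uniform_limit_theorem[rotated]) (use V_cont in \<open>auto intro!: always_eventually\<close>)
qed

text \<open>A Gronwall inequality for the weakly singular kernel.\<close>

lemma volterra_gronwall:
  assumes "c > 0"
  obtains \<kappa> where "\<kappa> > 0" and "\<And>\<theta> \<psi> A m \<tau>. \<lbrakk>\<theta> \<in> {0..T}; continuous_on {0..\<theta>} \<psi>;
      \<And>\<tau>. \<tau> \<in> {0..\<theta>} \<Longrightarrow> 0 \<le> \<psi> \<tau>; 0 \<le> A; m \<in> L_infty \<theta>;
      AE \<xi> in lebesgue_on {0..\<theta>}. norm (m \<xi>) \<le> c * \<psi> \<xi>;
      \<And>\<tau>. \<tau> \<in> {0..\<theta>} \<Longrightarrow> \<psi> \<tau> \<le> A + norm (volterra K \<tau> m); \<tau> \<in> {0..\<theta>}\<rbrakk>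
      \<Longrightarrow> \<psi> \<tau> \<le> 2 * A * exp (\<kappa> * \<tau>)"
proof -
  have "1 / (2 * c) > 0" using assms by simp
  then obtain \<kappa> where \<kappa>: "\<kappa> > 0" and wb: "\<And>D \<tau> l. \<lbrakk>0 \<le> D; \<tau> \<in> {0..T}; l \<in> L_infty \<tau>;
      AE \<xi> in lebesgue_on {0..\<tau>}. norm (l \<xi>) \<le> D * exp (\<kappa> * \<xi>)\<rbrakk>
      \<Longrightarrow> norm (volterra K \<tau> l) \<le> 1 / (2 * c) * D * exp (\<kappa> * \<tau>)"
    by (rule volterra_weighted_bound) blast
  have "\<psi> \<tau> \<le> 2 * A * exp (\<kappa> * \<tau>)"
    if \<theta>: "\<theta> \<in> {0..T}" and cont: "continuous_on {0..\<theta>} \<psi>"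
      and \<psi>0: "\<And>\<tau>. \<tau> \<in> {0..\<theta>} \<Longrightarrow> 0 \<le> \<psi> \<tau>" and A: "0 \<le> A" and m: "m \<in> L_infty \<theta>"
      and m\<psi>: "AE \<xi> in lebesgue_on {0..\<theta>}. norm (m \<xi>) \<le> c * \<psi> \<xi>"
      and ineq: "\<And>\<tau>. \<tau> \<in> {0..\<theta>} \<Longrightarrow> \<psi> \<tau> \<le> A + norm (volterra K \<tau> m)" and \<tau>: "\<tau> \<in> {0..\<theta>}"
    for \<theta> \<psi> A m \<tau>
  proof -
    have "continuous_on {0..\<theta>} (\<lambda>\<tau>. exp (- (\<kappa> * \<tau>)) * \<psi> \<tau>)"
      using cont by (intro continuous_intros)
    then have "\<exists>s\<in>{0..\<theta>}. \<forall>\<tau>\<in>{0..\<theta>}. exp (- (\<kappa> * \<tau>)) * \<psi> \<tau> \<le> exp (- (\<kappa> * s)) * \<psi> s"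
      using \<theta> by (intro continuous_attains_sup) auto
    then obtain s where s: "s \<in> {0..\<theta>}"
      and max: "\<And>\<tau>. \<tau> \<in> {0..\<theta>} \<Longrightarrow> exp (- (\<kappa> * \<tau>)) * \<psi> \<tau> \<le> exp (- (\<kappa> * s)) * \<psi> s"
      by blast
    \<comment> \<open>the weighted supremum norm of \<open>\<psi>\<close>; at \<open>s\<close> the inequality gives \<open>S \<le> A + S / 2\<close>\<close>
    define S where "S = exp (- (\<kappa> * s)) * \<psi> s"
    have S: "S \<ge> 0" using \<psi>0[OF s] by (simp add: S_def)
    have \<psi>S: "\<psi> \<xi> \<le> S * exp (\<kappa> * \<xi>)" if "\<xi> \<in> {0..\<theta>}" for \<xi>
    proof -
      have "\<psi> \<xi> = (exp (- (\<kappa> * \<xi>)) * \<psi> \<xi>) * exp (\<kappa> * \<xi>)"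
        by (simp add: exp_minus)
      also have "\<dots> \<le> S * exp (\<kappa> * \<xi>)"
        unfolding S_def by (intro mult_right_mono max that) auto
      finally show ?thesis .
    qed
    have "AE \<xi> in lebesgue_on {0..s}. norm (m \<xi>) \<le> c * \<psi> \<xi>"
      by (rule AE_lebesgue_on_subinterval[OF m\<psi>]) (use s in auto)
    then have "AE \<xi> in lebesgue_on {0..s}. norm (m \<xi>) \<le> c * S * exp (\<kappa> * \<xi>)"
      using AE_space
    proof eventually_elim
      case (elim \<xi>)
      have "c * \<psi> \<xi> \<le> c * (S * exp (\<kappa> * \<xi>))"
        using elim s assms by (intro mult_left_mono \<psi>S) auto
      with elim show ?case by (simp add: mult.assoc)
    qed
    then have "norm (volterra K s m) \<le> 1 / (2 * c) * (c * S) * exp (\<kappa> * s)"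
      using s \<theta> S assms L_infty_mono[OF m, of s] by (intro wb) auto
    also have "\<dots> = S / 2 * exp (\<kappa> * s)"
      using assms by simp
    finally have "\<psi> s \<le> A + S / 2 * exp (\<kappa> * s)"
      using ineq[OF s] by simp
    then have "S \<le> exp (- (\<kappa> * s)) * (A + S / 2 * exp (\<kappa> * s))"
      unfolding S_def by (intro mult_left_mono) auto
    also have "\<dots> = exp (- (\<kappa> * s)) * A + S / 2"
      by (simp add: exp_minus field_simps)
    also have "exp (- (\<kappa> * s)) * A \<le> A"
      using A s \<kappa> by (intro mult_left_le_one_le) auto
    finally have "S \<le> 2 * A" by simp
    then show ?thesis
      using \<psi>S[OF \<tau>] by (meson exp_ge_zero mult_right_mono order_trans)
  qed
  with \<kappa> show thesis by (rule that)
qed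


subsection \<open>Solvability of the Volterra equation\<close>

text \<open>
  For a globally Lipschitz right-hand side, \<open>z(\<tau>) = e\<^sup>-\<^sup>\<kappa>\<^sup>\<tau>x(\<tau>)\<close> is the fixed point of a contraction for
  the supremum norm.
\<close>

lemma volterra_equation_lipschitz:
  assumes g: "continuous_on {0..T} g"
    and bdd: "\<And>z. continuous_on {0..T} z \<Longrightarrow> (\<lambda>\<xi>. F \<xi> (z \<xi>)) \<in> L_infty T"
    and L: "L > 0"
    and lip: "\<And>\<xi> z z'. \<xi> \<in> {0..T} \<Longrightarrow> norm (F \<xi> z - F \<xi> z') \<le> L * norm (z - z')"
  obtains x where "continuous_on {0..T} x"
    and "\<And>\<tau>. \<tau> \<in> {0..T} \<Longrightarrow> x \<tau> = g \<tau> + volterra K \<tau> (\<lambda>\<xi>. F \<xi> (x \<xi>))"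
proof -
  have "1 / (2 * L) > 0" using L by simp
  then obtain \<kappa> where \<kappa>: "\<kappa> > 0" and wb: "\<And>D \<tau> l. \<lbrakk>0 \<le> D; \<tau> \<in> {0..T}; l \<in> L_infty \<tau>;
      AE \<xi> in lebesgue_on {0..\<tau>}. norm (l \<xi>) \<le> D * exp (\<kappa> * \<xi>)\<rbrakk>
      \<Longrightarrow> norm (volterra K \<tau> l) \<le> 1 / (2 * L) * D * exp (\<kappa> * \<tau>)"
    by (rule volterra_weighted_bound) blast
  define m where "m z \<xi> = F \<xi> (exp (\<kappa> * \<xi>) *\<^sub>R apply_bcontfun z \<xi>)" for z \<xi>
  define G where "G z \<tau> = exp (- (\<kappa> * \<tau>)) *\<^sub>R (g \<tau> + volterra K \<tau> (m z))" for z \<tau>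
  \<comment> \<open>extends functions on \<open>[0,T]\<close> by constants to bounded continuous functions on the line\<close>
  define c where "c \<tau> = max 0 (min T \<tau>)" for \<tau>
  have c: "c \<tau> \<in> {0..T}" for \<tau> using T_pos by (auto simp: c_def)
  have c_id: "c \<tau> = \<tau>" if "\<tau> \<in> {0..T}" for \<tau> using that by (auto simp: c_def)
  have m_L: "m z \<in> L_infty T" for z
    unfolding m_def by (intro bdd continuous_intros continuous_on_apply_bcontfun)
  have G_cont: "continuous_on {0..T} (G z)" for z
    unfolding G_def by (intro continuous_intros g continuous_on_volterra m_L)
  have "(\<lambda>\<tau>. G z (c \<tau>)) \<in> bcontfun" for z
  proof -
    have "continuous_on UNIV (\<lambda>\<tau>. G z (c \<tau>))"
      by (rule continuous_on_compose2[OF G_cont]) (use c in \<open>auto simp: c_def intro!: continuous_intros\<close>)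
    moreover have "bounded (range (\<lambda>\<tau>. G z (c \<tau>)))"
      using c by (intro bounded_subset[OF compact_imp_bounded[OF compact_continuous_image[OF G_cont[of z]]]]) auto
    ultimately show ?thesis by (simp add: bcontfun_def)
  qed
  then have ap: "apply_bcontfun (Bcontfun (\<lambda>\<tau>. G z (c \<tau>))) \<tau> = G z (c \<tau>)" for z \<tau>
    by (simp add: Bcontfun_inverse)
  have "\<forall>z z' :: real \<Rightarrow>\<^sub>C (real^'n). dist (Bcontfun (\<lambda>\<tau>. G z (c \<tau>))) (Bcontfun (\<lambda>\<tau>. G z' (c \<tau>))) \<le> 1 / 2 * dist z z'"
  proof (intro allI dist_bound)
    fix z z' :: "real \<Rightarrow>\<^sub>C (real^'n)" and \<tau> :: real
    let ?\<tau> = "c \<tau>" and ?D = "dist z z'"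
    have \<tau>L: "m z \<in> L_infty ?\<tau>" "m z' \<in> L_infty ?\<tau>"
      using m_L c[of \<tau>] by (auto intro: L_infty_mono)
    have "norm (m z \<xi> - m z' \<xi>) \<le> L * ?D * exp (\<kappa> * \<xi>)" if "\<xi> \<in> {0..?\<tau>}" for \<xi>
    proof -
      have "norm (m z \<xi> - m z' \<xi>)
          \<le> L * norm (exp (\<kappa> * \<xi>) *\<^sub>R apply_bcontfun z \<xi> - exp (\<kappa> * \<xi>) *\<^sub>R apply_bcontfun z' \<xi>)"
        unfolding m_def using that c[of \<tau>] by (intro lip) auto
      also have "\<dots> = L * (exp (\<kappa> * \<xi>) * dist (apply_bcontfun z \<xi>) (apply_bcontfun z' \<xi>))"
        by (simp add: dist_norm scaleR_diff_right[symmetric])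
      also have "\<dots> \<le> L * (exp (\<kappa> * \<xi>) * ?D)"
        using L by (intro mult_left_mono dist_bounded) auto
      finally show ?thesis by (simp add: algebra_simps)
    qed
    then have "AE \<xi> in lebesgue_on {0..?\<tau>}. norm (m z \<xi> - m z' \<xi>) \<le> L * ?D * exp (\<kappa> * \<xi>)"
      unfolding AE_lebesgue_on_interval_iff by auto
    then have "norm (volterra K ?\<tau> (\<lambda>\<xi>. m z \<xi> - m z' \<xi>)) \<le> 1 / (2 * L) * (L * ?D) * exp (\<kappa> * ?\<tau>)"
      using L c \<tau>L by (intro wb L_infty_diff) auto
    then have *: "norm (volterra K ?\<tau> (m z) - volterra K ?\<tau> (m z')) \<le> 1 / 2 * ?D * exp (\<kappa> * ?\<tau>)"
      using L c \<tau>L by (simp add: volterra_diff)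
    have "dist (G z ?\<tau>) (G z' ?\<tau>)
        = exp (- (\<kappa> * ?\<tau>)) * norm (volterra K ?\<tau> (m z) - volterra K ?\<tau> (m z'))"
      by (simp add: G_def dist_norm scaleR_diff_right[symmetric])
    also have "\<dots> \<le> exp (- (\<kappa> * ?\<tau>)) * (1 / 2 * ?D * exp (\<kappa> * ?\<tau>))"
      by (intro mult_left_mono *) auto
    also have "\<dots> = 1 / 2 * ?D"
      by (simp add: exp_minus field_simps)
    finally show "dist (apply_bcontfun (Bcontfun (\<lambda>\<tau>. G z (c \<tau>))) \<tau>)
        (apply_bcontfun (Bcontfun (\<lambda>\<tau>. G z' (c \<tau>))) \<tau>) \<le> 1 / 2 * ?D"
      by (simp add: ap)
  qed
  then obtain z where z: "Bcontfun (\<lambda>\<tau>. G z (c \<tau>)) = z"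
    using banach_fix_type[of "1 / 2" "\<lambda>z. Bcontfun (\<lambda>\<tau>. G z (c \<tau>))"] by auto
  define x where "x \<tau> = exp (\<kappa> * \<tau>) *\<^sub>R apply_bcontfun z \<tau>" for \<tau>
  have x_eq: "x \<tau> = g \<tau> + volterra K \<tau> (\<lambda>\<xi>. F \<xi> (x \<xi>))" if "\<tau> \<in> {0..T}" for \<tau>
  proof -
    have "apply_bcontfun z \<tau> = G z \<tau>"
      using ap[of z \<tau>] z c_id[OF that] by simp
    moreover have "m z = (\<lambda>\<xi>. F \<xi> (x \<xi>))"
      by (simp add: m_def x_def fun_eq_iff)
    ultimately show ?thesis
      by (simp add: x_def[of \<tau>] G_def exp_minus)
  qed
  have "continuous_on {0..T} x"
    unfolding x_def by (intro continuous_intros continuous_on_apply_bcontfun)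
  then show thesis using x_eq by (rule that)
qed

text \<open>
  Under a linear growth condition a local Lipschitz condition suffices: solutions of the equation
  whose right-hand side is cut off outside a large ball stay inside that ball.
\<close>

lemma volterra_equation_has_solution:
  assumes g: "continuous_on {0..T} g"
    and meas: "\<And>z. continuous_on {0..T} z \<Longrightarrow> (\<lambda>\<xi>. F \<xi> (z \<xi>)) \<in> borel_measurable (lebesgue_on {0..T})"
    and c: "c > 0"
    and growth: "\<And>\<xi> z. \<xi> \<in> {0..T} \<Longrightarrow> norm (F \<xi> z) \<le> c * (1 + norm z)"
    and lip: "\<And>R. R > 0 \<Longrightarrow> \<exists>L>0. \<forall>\<xi>\<in>{0..T}. \<forall>z\<in>cball 0 R. \<forall>z'\<in>cball 0 R.
        norm (F \<xi> z - F \<xi> z') \<le> L * norm (z - z')"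
  obtains x where "continuous_on {0..T} x"
    and "\<And>\<tau>. \<tau> \<in> {0..T} \<Longrightarrow> x \<tau> = g \<tau> + volterra K \<tau> (\<lambda>\<xi>. F \<xi> (x \<xi>))"
proof -
  have "bounded (g ` {0..T})"
    using g by (intro compact_imp_bounded compact_continuous_image) auto
  then obtain A0 where A0: "A0 > 0" "\<And>\<tau>. \<tau> \<in> {0..T} \<Longrightarrow> norm (g \<tau>) \<le> A0"
    unfolding bounded_pos by blast
  obtain \<kappa> where \<kappa>: "\<kappa> > 0" and gronwall: "\<And>\<theta> \<psi> A m \<tau>. \<lbrakk>\<theta> \<in> {0..T}; continuous_on {0..\<theta>} \<psi>;
      \<And>\<tau>. \<tau> \<in> {0..\<theta>} \<Longrightarrow> 0 \<le> \<psi> \<tau>; 0 \<le> A; m \<in> L_infty \<theta>;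
      AE \<xi> in lebesgue_on {0..\<theta>}. norm (m \<xi>) \<le> c * \<psi> \<xi>;
      \<And>\<tau>. \<tau> \<in> {0..\<theta>} \<Longrightarrow> \<psi> \<tau> \<le> A + norm (volterra K \<tau> m); \<tau> \<in> {0..\<theta>}\<rbrakk>
      \<Longrightarrow> \<psi> \<tau> \<le> 2 * A * exp (\<kappa> * \<tau>)"
    using volterra_gronwall[OF c] by blast
  \<comment> \<open>the bound that the Gronwall inequality yields for \<open>1 + norm (x \<tau>)\<close>\<close>
  define R where "R = 2 * (1 + A0) * exp (\<kappa> * T)"
  have R: "R > 0" using A0 by (auto simp: R_def)
  obtain L where L: "L > 0" "\<And>\<xi> z z'. \<lbrakk>\<xi> \<in> {0..T}; z \<in> cball 0 R; z' \<in> cball 0 R\<rbrakk> \<Longrightarrow>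
      norm (F \<xi> z - F \<xi> z') \<le> L * norm (z - z')"
    using lip[OF R] by blast
  let ?p = "closest_point (cball (0::real^'n) R)"
  have ball: "convex (cball (0::real^'n) R)" "closed (cball (0::real^'n) R)" "cball (0::real^'n) R \<noteq> {}"
    using R by auto
  have p_in: "?p z \<in> cball 0 R" for z
    using ball by (intro closest_point_in_set)
  have p_lip: "norm (?p z - ?p z') \<le> norm (z - z')" for z z'
    using closest_point_lipschitz[OF ball, of z z'] by (simp add: dist_norm)
  have p_id: "?p z = z" if "norm z \<le> R" for z
    using that by (intro closest_point_self) simp
  have p_norm: "norm (?p z) \<le> norm z" for z
    using p_lip[of z 0] p_id[of 0] R by simp
  have p_cont: "continuous_on {0..T} (\<lambda>\<xi>. ?p (z \<xi>))" if "continuous_on {0..T} z" for z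
    by (rule continuous_on_compose2[OF continuous_on_closest_point[OF ball] that]) auto
  have cut_L: "(\<lambda>\<xi>. F \<xi> (?p (z \<xi>))) \<in> L_infty T" if "continuous_on {0..T} z" for z
  proof (rule L_inftyI_bounded)
    show "(\<lambda>\<xi>. F \<xi> (?p (z \<xi>))) \<in> borel_measurable (lebesgue_on {0..T})"
      using p_cont[OF that] by (rule meas)
    fix \<xi> assume "\<xi> \<in> {0..T}"
    then have "norm (F \<xi> (?p (z \<xi>))) \<le> c * (1 + norm (?p (z \<xi>)))"
      by (rule growth)
    also have "\<dots> \<le> c * (1 + R)"
      using p_in[of "z \<xi>"] c by (intro mult_left_mono) auto
    finally show "norm (F \<xi> (?p (z \<xi>))) \<le> c * (1 + R)" .
  qed
  have cut_lip: "norm (F \<xi> (?p z) - F \<xi> (?p z')) \<le> L * norm (z - z')" if "\<xi> \<in> {0..T}" for \<xi> z z'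
  proof -
    have "norm (F \<xi> (?p z) - F \<xi> (?p z')) \<le> L * norm (?p z - ?p z')"
      using that p_in by (intro L(2))
    also have "\<dots> \<le> L * norm (z - z')"
      using L(1) p_lip by (intro mult_left_mono) auto
    finally show ?thesis .
  qed
  obtain x where x: "continuous_on {0..T} x"
    "\<And>\<tau>. \<tau> \<in> {0..T} \<Longrightarrow> x \<tau> = g \<tau> + volterra K \<tau> (\<lambda>\<xi>. F \<xi> (?p (x \<xi>)))"
    using volterra_equation_lipschitz[OF g cut_L L(1) cut_lip] by blast
  have x_bound: "norm (x \<tau>) \<le> R" if \<tau>: "\<tau> \<in> {0..T}" for \<tau>
  proof -
    have "1 + norm (x \<tau>) \<le> 2 * (1 + A0) * exp (\<kappa> * \<tau>)"
    proof (rule gronwall[where \<theta> = T and m = "\<lambda>\<xi>. F \<xi> (?p (x \<xi>))"])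
      show "continuous_on {0..T} (\<lambda>\<tau>. 1 + norm (x \<tau>))"
        using x(1) by (intro continuous_intros)
      have "norm (F \<xi> (?p (x \<xi>))) \<le> c * (1 + norm (x \<xi>))" if "\<xi> \<in> {0..T}" for \<xi>
      proof -
        have "c * (1 + norm (?p (x \<xi>))) \<le> c * (1 + norm (x \<xi>))"
          using p_norm c by (intro mult_left_mono add_left_mono) auto
        then show ?thesis using growth[OF that, of "?p (x \<xi>)"] by simp
      qed
      then show "AE \<xi> in lebesgue_on {0..T}. norm (F \<xi> (?p (x \<xi>))) \<le> c * (1 + norm (x \<xi>))"
        unfolding AE_lebesgue_on_interval_iff by auto
      fix s assume "s \<in> {0..T}"
      then show "1 + norm (x s) \<le> 1 + A0 + norm (volterra K s (\<lambda>\<xi>. F \<xi> (?p (x \<xi>))))"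
        using norm_triangle_ineq[of "g s" "volterra K s (\<lambda>\<xi>. F \<xi> (?p (x \<xi>)))"] A0(2)[of s] x(2)[of s]
        by simp
    qed (use T_pos A0 \<tau> cut_L[OF x(1)] in auto)
    also have "\<dots> \<le> R"
      unfolding R_def using \<tau> \<kappa> A0 by (intro mult_left_mono) auto
    finally show ?thesis by simp
  qed
  have "x \<tau> = g \<tau> + volterra K \<tau> (\<lambda>\<xi>. F \<xi> (x \<xi>))" if "\<tau> \<in> {0..T}" for \<tau>
  proof -
    have "volterra K \<tau> (\<lambda>\<xi>. F \<xi> (?p (x \<xi>))) = volterra K \<tau> (\<lambda>\<xi>. F \<xi> (x \<xi>))"
      using that x_bound p_id by (intro volterra_cong) auto
    then show ?thesis using x(2)[OF that] by simp
  qed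
  with x(1) show thesis by (rule that)
qed

end


section \<open>Controls\<close>

lemma controlsD:
  assumes "u \<in> controls t T S"
  shows "u \<in> extensional {t..T}" and "\<And>\<xi>. \<xi> \<in> {t..T} \<Longrightarrow> u \<xi> \<in> S"
    and "u \<in> borel_measurable (lebesgue_on {t..T})"
  using assms by (auto simp: controls_def PiE_def)

lemma restrict_controls:
  assumes "u \<in> controls t T S" and "t \<le> \<theta>"
  shows "restrict u {\<theta>..T} \<in> controls \<theta> T S"
proof -
  have "u \<in> borel_measurable (lebesgue_on {\<theta>..T})"
    by (rule borel_measurable_lebesgue_on_subinterval[OF controlsD(3)[OF assms(1)]]) (use assms in auto)
  then have "restrict u {\<theta>..T} \<in> borel_measurable (lebesgue_on {\<theta>..T})"
    by (rule iffD1[OF measurable_lebesgue_cong, rotated]) auto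
  then show ?thesis
    using assms controlsD(2)[OF assms(1)] by (auto simp: controls_def)
qed

text \<open>
  Concatenation of controls at time \<open>\<theta>\<close>. At \<open>\<theta>\<close> itself the second one decides, so that it is recovered
  exactly, and not just almost everywhere, by restriction to \<open>[\<theta>,T]\<close>.
\<close>

definition concat_controls :: "real \<Rightarrow> real \<Rightarrow> real \<Rightarrow> (real \<Rightarrow> 'a) \<Rightarrow> (real \<Rightarrow> 'a) \<Rightarrow> real \<Rightarrow> 'a" where
  "concat_controls t \<theta> T u u' = (\<lambda>\<tau>\<in>{t..T}. if \<tau> < \<theta> then u \<tau> else u' \<tau>)"

lemma concat_controls_in_controls:
  fixes S :: "(real^'m) set"
  assumes u: "u \<in> controls t T S" and u': "u' \<in> controls \<theta> T S" and \<theta>: "\<theta> \<in> {t..T}"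
  shows "concat_controls t \<theta> T u u' \<in> controls t T S"
proof -
  let ?u = "\<lambda>\<xi>. if \<xi> \<in> {t..T} then u \<xi> else 0" and ?u' = "\<lambda>\<xi>. if \<xi> \<in> {\<theta>..T} then u' \<xi> else 0"
  have "(\<lambda>\<xi>. if \<xi> < \<theta> then ?u \<xi> else ?u' \<xi>) \<in> borel_measurable lebesgue"
  proof (rule measurable_If)
    show "{x \<in> space lebesgue. x < \<theta>} \<in> sets lebesgue"
      by (simp add: lessThan_def[symmetric])
    show "?u \<in> borel_measurable lebesgue" "?u' \<in> borel_measurable lebesgue"
      using controlsD(3)[OF u] controlsD(3)[OF u']
      by (intro borel_measurable_if[THEN iffD2]; simp)+
  qed
  then have "(\<lambda>\<xi>. if \<xi> < \<theta> then ?u \<xi> else ?u' \<xi>) \<in> borel_measurable (lebesgue_on {t..T})"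
    by (rule measurable_restrict_space1)
  then have "concat_controls t \<theta> T u u' \<in> borel_measurable (lebesgue_on {t..T})"
    by (rule iffD1[OF measurable_lebesgue_cong, rotated]) (auto simp: concat_controls_def)
  then show ?thesis
    using controlsD(2)[OF u] controlsD(2)[OF u'] \<theta> by (auto simp: controls_def concat_controls_def)
qed

lemma restrict_concat_controls:
  assumes "u' \<in> controls \<theta> T S" and "\<theta> \<in> {t..T}"
  shows "restrict (concat_controls t \<theta> T u u') {\<theta>..T} = u'"
  using controlsD(1)[OF assms(1)] assms(2) by (intro extensionalityI) (auto simp: concat_controls_def)

lemma concat_controls_AE_eq:
  assumes "\<theta> \<in> {t..T}"
  shows "AE \<xi> in lebesgue_on {t..\<theta>}. concat_controls t \<theta> T u u' \<xi> = u \<xi>"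
  unfolding AE_lebesgue_on_interval_iff using AE_lebesgue_neq[of \<theta>]
  by eventually_elim (use assms in \<open>auto simp: concat_controls_def\<close>)

lemma AE_lebesgue_on_restrict_iff:
  assumes "{a..b} \<subseteq> A"
  shows "(AE \<xi> in lebesgue_on {a..b::real}. restrict u A \<xi> = restrict u' A \<xi>)
    \<longleftrightarrow> (AE \<xi> in lebesgue_on {a..b}. u \<xi> = u' \<xi>)"
  unfolding AE_lebesgue_on_interval_iff by (rule AE_cong) (use assms in auto)

lemma strategiesD:
  assumes "a \<in> strategies t T S S'"
  shows "\<And>v. v \<in> controls t T S \<Longrightarrow> a v \<in> controls t T S'"
    and "\<And>\<theta> v v'. \<lbrakk>\<theta> \<in> {t..T}; v \<in> controls t T S; v' \<in> controls t T S;
      AE \<tau> in lebesgue_on {t..\<theta>}. v \<tau> = v' \<tau>\<rbrakk> \<Longrightarrow> AE \<tau> in lebesgue_on {t..\<theta>}. a v \<tau> = a v' \<tau>"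
  using assms by (auto simp: strategies_def)

text \<open>The strategy for the remaining game that a strategy induces once the opponent has played \<open>v\<close> up to \<open>\<theta>\<close>.\<close>

lemma tail_strategy:
  fixes S :: "(real^'m) set" and S' :: "(real^'k) set"
  assumes a: "a \<in> strategies t T S S'" and v: "v \<in> controls t T S" and \<theta>: "\<theta> \<in> {t..T}"
  shows "(\<lambda>v'\<in>controls \<theta> T S. restrict (a (concat_controls t \<theta> T v v')) {\<theta>..T}) \<in> strategies \<theta> T S S'"
proof -
  let ?V = "\<lambda>v'. concat_controls t \<theta> T v v'"
  have V: "?V v' \<in> controls t T S" if "v' \<in> controls \<theta> T S" for v'
    using v that \<theta> by (rule concat_controls_in_controls)
  have "AE \<tau> in lebesgue_on {\<theta>..s}. restrict (a (?V v')) {\<theta>..T} \<tau> = restrict (a (?V v'')) {\<theta>..T} \<tau>"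
    if s: "s \<in> {\<theta>..T}" and v': "v' \<in> controls \<theta> T S" and v'': "v'' \<in> controls \<theta> T S"
      and eq: "AE \<tau> in lebesgue_on {\<theta>..s}. v' \<tau> = v'' \<tau>" for s v' v''
  proof -
    have "AE \<tau> in lebesgue_on {t..s}. ?V v' \<tau> = ?V v'' \<tau>"
      using eq unfolding AE_lebesgue_on_interval_iff
      by eventually_elim (use s \<theta> in \<open>auto simp: concat_controls_def\<close>)
    then have "AE \<tau> in lebesgue_on {t..s}. a (?V v') \<tau> = a (?V v'') \<tau>"
      using s \<theta> V[OF v'] V[OF v''] by (intro strategiesD(2)[OF a]) auto
    then have "AE \<tau> in lebesgue_on {\<theta>..s}. a (?V v') \<tau> = a (?V v'') \<tau>"
      by (rule AE_lebesgue_on_subinterval) (use \<theta> in auto)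
    then show ?thesis
      using s by (subst AE_lebesgue_on_restrict_iff) auto
  qed
  moreover have "restrict (a (?V v')) {\<theta>..T} \<in> controls \<theta> T S'" if "v' \<in> controls \<theta> T S" for v'
    using strategiesD(1)[OF a V[OF that]] \<theta> by (intro restrict_controls) auto
  ultimately show ?thesis
    unfolding strategies_def by auto
qed

text \<open>
  A strategy may be continued after \<open>\<theta>\<close> by a strategy selected by what has happened so far, as long
  as the selection depends only on the equivalence class of the opponent's control on \<open>[t,\<theta>]\<close>.
\<close>

lemma continued_strategy:
  fixes S :: "(real^'m) set" and S' :: "(real^'k) set"
  assumes a: "a \<in> strategies t T S S'" and \<theta>: "\<theta> \<in> {t..T}"
    and A: "\<And>v. v \<in> controls t T S \<Longrightarrow> A v \<in> strategies \<theta> T S S'"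
    and A_cong: "\<And>v v'. \<lbrakk>v \<in> controls t T S; v' \<in> controls t T S;
      AE \<tau> in lebesgue_on {t..\<theta>}. v \<tau> = v' \<tau>\<rbrakk> \<Longrightarrow> A v = A v'"
  shows "(\<lambda>v\<in>controls t T S. concat_controls t \<theta> T (a v) (A v (restrict v {\<theta>..T}))) \<in> strategies t T S S'"
proof -
  let ?b = "\<lambda>v. concat_controls t \<theta> T (a v) (A v (restrict v {\<theta>..T}))"
  have r: "restrict v {\<theta>..T} \<in> controls \<theta> T S" if "v \<in> controls t T S" for v
    using that \<theta> by (intro restrict_controls) auto
  have b: "?b v \<in> controls t T S'" if "v \<in> controls t T S" for v
    using strategiesD(1)[OF a that] strategiesD(1)[OF A[OF that] r[OF that]] \<theta> by (rule concat_controls_in_controls)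
  have "AE \<tau> in lebesgue_on {t..s}. ?b v \<tau> = ?b v' \<tau>"
    if s: "s \<in> {t..T}" and v: "v \<in> controls t T S" and v': "v' \<in> controls t T S"
      and eq: "AE \<tau> in lebesgue_on {t..s}. v \<tau> = v' \<tau>" for s v v'
  proof -
    have aeq: "AE \<tau> in lebesgue_on {t..s}. a v \<tau> = a v' \<tau>"
      using s v v' eq by (rule strategiesD(2)[OF a])
    show ?thesis
    proof (cases "s < \<theta>")
      case True
      show ?thesis
        using aeq unfolding AE_lebesgue_on_interval_iff
        by eventually_elim (use True in \<open>auto simp: concat_controls_def\<close>)
    next
      case False
      have "AE \<tau> in lebesgue_on {t..\<theta>}. v \<tau> = v' \<tau>"
        by (rule AE_lebesgue_on_subinterval[OF eq]) (use False in auto)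
      with v v' have A_eq: "A v = A v'" by (rule A_cong)
      have "AE \<tau> in lebesgue_on {\<theta>..s}. v \<tau> = v' \<tau>"
        by (rule AE_lebesgue_on_subinterval[OF eq]) (use \<theta> in auto)
      then have "AE \<tau> in lebesgue_on {\<theta>..s}. restrict v {\<theta>..T} \<tau> = restrict v' {\<theta>..T} \<tau>"
        using s by (subst AE_lebesgue_on_restrict_iff) auto
      then have "AE \<tau> in lebesgue_on {\<theta>..s}. A v (restrict v {\<theta>..T}) \<tau> = A v' (restrict v' {\<theta>..T}) \<tau>"
        unfolding A_eq using False s r v v' by (intro strategiesD(2)[OF A[OF v']]) auto
      with aeq show ?thesis
        unfolding AE_lebesgue_on_interval_iff
        by eventually_elim (auto simp: concat_controls_def)
    qed
  qed
  with b show ?thesis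
    unfolding strategies_def by auto
qed


section \<open>Motions\<close>

lemma mspace_C_space:
  "mspace (C_space T) = {x \<in> extensional {0..T}. continuous_on {0..T} x}"
  unfolding C_space_def by (subst compactin_mspace_cfunspace) auto

text \<open>
  The density that generates a motion: the density \<open>l\<close> of the initial history before \<open>t\<close>, the
  dynamics afterwards.
\<close>

definition motion_density ::
  "(real \<Rightarrow> real^'n \<Rightarrow> real^'p \<Rightarrow> real^'q \<Rightarrow> real^'n) \<Rightarrow> real \<Rightarrow> (real \<Rightarrow> real^'n) \<Rightarrow>
     (real \<Rightarrow> real^'n) \<Rightarrow> (real \<Rightarrow> real^'p) \<Rightarrow> (real \<Rightarrow> real^'q) \<Rightarrow> real \<Rightarrow> real^'n" where
  "motion_density f t l x u v \<xi> = (if \<xi> < t then l \<xi> else f \<xi> (x \<xi>) (u \<xi>) (v \<xi>))"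

text \<open>
  A motion and its initial history together solve a single integral equation on \<open>[0,b]\<close> that has the
  same form at every initial time.
\<close>

definition solves ::
  "(real \<Rightarrow> real^'n) \<Rightarrow> (real \<Rightarrow> real \<Rightarrow> real^'n^'n) \<Rightarrow>
     (real \<Rightarrow> real^'n \<Rightarrow> real^'p \<Rightarrow> real^'q \<Rightarrow> real^'n) \<Rightarrow> real \<Rightarrow> real \<Rightarrow> (real \<Rightarrow> real^'n) \<Rightarrow>
     (real \<Rightarrow> real^'p) \<Rightarrow> (real \<Rightarrow> real^'q) \<Rightarrow> (real \<Rightarrow> real^'n) \<Rightarrow> bool" where
  "solves y K f b t l u v x \<longleftrightarrow> continuous_on {0..b} x \<and>
     (\<forall>\<tau>\<in>{0..b}. x \<tau> = y \<tau> + volterra K \<tau> (motion_density f t l x u v))"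

text \<open>
  The controlled dynamics without the costs, on which the motions do not depend. In this form both
  the game and the one with exchanged players are instances.
\<close>

locale controlled_volterra_system = weakly_singular_kernel T \<alpha> K Kstar
  for T \<alpha> :: real and K Kstar :: "real \<Rightarrow> real \<Rightarrow> real^'n^'n" +
  fixes P :: "(real^'p) set" and Q :: "(real^'q) set"
    and y :: "real \<Rightarrow> real^'n"
    and f :: "real \<Rightarrow> real^'n \<Rightarrow> real^'p \<Rightarrow> real^'q \<Rightarrow> real^'n"
  assumes P_compact: "compact P" and Q_compact: "compact Q"
    and y_cont: "continuous_on {0..T} y"
    and f_cont: "continuous_on ({0..T} \<times> UNIV \<times> P \<times> Q) (\<lambda>(\<tau>, x, u, v). f \<tau> x u v)"
    and f_lipschitz: "\<forall>R>0. \<exists>L>0. \<forall>\<tau>\<in>{0..T}. \<forall>x\<in>cball 0 R. \<forall>x'\<in>cball 0 R. \<forall>u\<in>P. \<forall>v\<in>Q.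
           norm (f \<tau> x u v - f \<tau> x' u v) \<le> L * norm (x - x')"
    and f_growth: "\<exists>c>0. \<forall>\<tau>\<in>{0..T}. \<forall>x. \<forall>u\<in>P. \<forall>v\<in>Q. norm (f \<tau> x u v) \<le> c * (1 + norm x)"
    and K_injective: "\<forall>s\<in>{0<..T}. \<forall>l\<in>L_infty s.
           (\<forall>\<tau>\<in>{0..s}. (LINT \<xi>:{0..\<tau>}|lebesgue. K \<tau> \<xi> *v l \<xi>) = 0) \<longrightarrow>
           (AE \<xi> in lebesgue_on {0..s}. l \<xi> = 0)"
begin

lemma f_lipschitzE:
  assumes "R > 0"
  obtains L where "L > 0"
    and "\<And>\<tau> z z' p q. \<lbrakk>\<tau> \<in> {0..T}; z \<in> cball 0 R; z' \<in> cball 0 R; p \<in> P; q \<in> Q\<rbrakk>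
      \<Longrightarrow> norm (f \<tau> z p q - f \<tau> z' p q) \<le> L * norm (z - z')"
proof -
  obtain L where "L > 0" and L: "\<forall>\<tau>\<in>{0..T}. \<forall>z\<in>cball 0 R. \<forall>z'\<in>cball 0 R. \<forall>p\<in>P. \<forall>q\<in>Q.
      norm (f \<tau> z p q - f \<tau> z' p q) \<le> L * norm (z - z')"
    using spec[OF f_lipschitz, of R] assms by (elim impE exE conjE) auto
  show thesis
    by (rule that[OF \<open>L > 0\<close>]) (rule L[rule_format])
qed

lemma
  fixes h :: "real \<Rightarrow> real^'n \<Rightarrow> real^'p \<Rightarrow> real^'q \<Rightarrow> 'b::euclidean_space"
  assumes h: "continuous_on ({0..T} \<times> UNIV \<times> P \<times> Q) (\<lambda>(\<tau>, x, u, v). h \<tau> x u v)"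
    and ab: "0 \<le> t" "b \<le> T" and x: "continuous_on {t..b} x"
    and u: "u \<in> controls t T P" and v: "v \<in> controls t T Q"
  shows borel_measurable_along_controls:
      "(\<lambda>\<xi>. h \<xi> (x \<xi>) (u \<xi>) (v \<xi>)) \<in> borel_measurable (lebesgue_on {t..b})"
    and bounded_along_controls: "\<exists>C. \<forall>\<xi>\<in>{t..b}. norm (h \<xi> (x \<xi>) (u \<xi>) (v \<xi>)) \<le> C"
proof -
  let ?D = "{0..T} \<times> UNIV \<times> P \<times> Q" and ?h = "\<lambda>(\<tau>, x, u, v). h \<tau> x u v"
  have in_P: "u \<xi> \<in> P" and in_Q: "v \<xi> \<in> Q" if "\<xi> \<in> {t..b}" for \<xi>
    using controlsD(2)[OF u] controlsD(2)[OF v] that ab by auto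
  have [measurable]: "u \<in> borel_measurable (lebesgue_on {t..b})" "v \<in> borel_measurable (lebesgue_on {t..b})"
    "x \<in> borel_measurable (lebesgue_on {t..b})" "(\<lambda>\<xi>. \<xi>) \<in> borel_measurable (lebesgue_on {t..b})"
    using controlsD(3)[OF u] controlsD(3)[OF v] ab x
    by (auto intro!: continuous_on_imp_borel_measurable_lebesgue_on continuous_intros
        elim!: borel_measurable_lebesgue_on_subinterval)
  have "(\<lambda>\<xi>. (\<xi>, x \<xi>, u \<xi>, v \<xi>)) \<in> borel_measurable (lebesgue_on {t..b})"
    by measurable
  then have path: "(\<lambda>\<xi>. (\<xi>, x \<xi>, u \<xi>, v \<xi>)) \<in> measurable (lebesgue_on {t..b}) (restrict_space borel ?D)"
    using in_P in_Q ab by (intro measurable_restrict_space2) auto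
  have "?h \<in> borel_measurable (restrict_space borel ?D)"
    using h by (rule borel_measurable_continuous_on_restrict)
  from measurable_compose[OF path this] show "(\<lambda>\<xi>. h \<xi> (x \<xi>) (u \<xi>) (v \<xi>)) \<in> borel_measurable (lebesgue_on {t..b})"
    by simp
  let ?C = "{0..T} \<times> x ` {t..b} \<times> P \<times> Q"
  have "compact ?C"
    using P_compact Q_compact x by (intro compact_Times compact_continuous_image) auto
  moreover have "continuous_on ?C ?h"
    using h by (rule continuous_on_subset) auto
  ultimately have "bounded (?h ` ?C)"
    by (intro compact_imp_bounded compact_continuous_image)
  then obtain C where C: "\<And>p. p \<in> ?C \<Longrightarrow> norm (?h p) \<le> C"
    unfolding bounded_iff by blast
  have "norm (h \<xi> (x \<xi>) (u \<xi>) (v \<xi>)) \<le> C" if "\<xi> \<in> {t..b}" for \<xi>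
    using C[of "(\<xi>, x \<xi>, u \<xi>, v \<xi>)"] in_P[OF that] in_Q[OF that] that ab by auto
  then show "\<exists>C. \<forall>\<xi>\<in>{t..b}. norm (h \<xi> (x \<xi>) (u \<xi>) (v \<xi>)) \<le> C" by blast
qed

lemma set_integrable_along_controls:
  fixes h :: "real \<Rightarrow> real^'n \<Rightarrow> real^'p \<Rightarrow> real^'q \<Rightarrow> 'b::euclidean_space"
  assumes h: "continuous_on ({0..T} \<times> UNIV \<times> P \<times> Q) (\<lambda>(\<tau>, x, u, v). h \<tau> x u v)"
    and ab: "0 \<le> t" "b \<le> T" and x: "continuous_on {t..b} x"
    and u: "u \<in> controls t T P" and v: "v \<in> controls t T Q"
  shows "set_integrable lebesgue {t..b} (\<lambda>\<xi>. h \<xi> (x \<xi>) (u \<xi>) (v \<xi>))"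
proof -
  obtain C where C: "\<And>\<xi>. \<xi> \<in> {t..b} \<Longrightarrow> norm (h \<xi> (x \<xi>) (u \<xi>) (v \<xi>)) \<le> C"
    using bounded_along_controls[OF assms] by blast
  have "integrable (lebesgue_on {t..b}) (\<lambda>\<xi>. h \<xi> (x \<xi>) (u \<xi>) (v \<xi>))"
  proof (rule Bochner_Integration.integrable_bound)
    show "integrable (lebesgue_on {t..b}) (\<lambda>_. C)"
      by (simp add: integrable_restrict_space)
    show "AE \<xi> in lebesgue_on {t..b}. norm (h \<xi> (x \<xi>) (u \<xi>) (v \<xi>)) \<le> norm C"
      using C unfolding AE_lebesgue_on_interval_iff by (auto intro!: always_eventually order_trans[OF C abs_ge_self])
  qed (rule borel_measurable_along_controls[OF assms])
  then show ?thesis by (simp add: set_integrable_interval_iff)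
qed

lemma motion_density_L_infty:
  assumes "0 \<le> t" "t \<le> b" "b \<le> T" and l: "l \<in> L_infty t" and x: "continuous_on {0..b} x"
    and u: "u \<in> controls t T P" and v: "v \<in> controls t T Q"
  shows "motion_density f t l x u v \<in> L_infty b"
proof -
  have x': "continuous_on {t..b} x"
    using x by (rule continuous_on_subset) (use assms in auto)
  obtain C where "\<And>\<xi>. \<xi> \<in> {t..b} \<Longrightarrow> norm (f \<xi> (x \<xi>) (u \<xi>) (v \<xi>)) \<le> C"
    using bounded_along_controls[OF f_cont assms(1,3) x' u v] by blast
  then show ?thesis
    unfolding motion_density_def
    using l assms borel_measurable_along_controls[OF f_cont assms(1,3) x' u v]
    by (intro L_infty_if_less) auto
qed

text \<open>A solution up to time \<open>b\<close> depends only on the equivalence classes of the controls on \<open>[t,b]\<close>.\<close>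

lemma solves_unique:
  assumes tb: "0 \<le> t" "t \<le> b" "b \<le> T" and l: "l \<in> L_infty t"
    and u: "u \<in> controls t T P" "u' \<in> controls t T P" and v: "v \<in> controls t T Q" "v' \<in> controls t T Q"
    and eq: "AE \<xi> in lebesgue_on {t..b}. u \<xi> = u' \<xi>" "AE \<xi> in lebesgue_on {t..b}. v \<xi> = v' \<xi>"
    and x: "solves y K f b t l u v x" and x': "solves y K f b t l u' v' x'"
    and \<tau>: "\<tau> \<in> {0..b}"
  shows "x \<tau> = x' \<tau>"
proof -
  have cont: "continuous_on {0..b} x" "continuous_on {0..b} x'"
    using x x' by (auto simp: solves_def)
  have "bounded (x ` {0..b} \<union> x' ` {0..b})"
    using cont unfolding bounded_Un by (intro conjI compact_imp_bounded compact_continuous_image) auto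
  then obtain R where R: "R > 0" "\<And>\<xi>. \<xi> \<in> {0..b} \<Longrightarrow> x \<xi> \<in> cball 0 R \<and> x' \<xi> \<in> cball 0 R"
    unfolding bounded_pos by auto
  obtain L where L: "L > 0" "\<And>\<xi> z z' p q. \<lbrakk>\<xi> \<in> {0..T}; z \<in> cball 0 R; z' \<in> cball 0 R; p \<in> P; q \<in> Q\<rbrakk>
      \<Longrightarrow> norm (f \<xi> z p q - f \<xi> z' p q) \<le> L * norm (z - z')"
    by (rule f_lipschitzE[OF R(1)]) blast
  let ?m = "motion_density f t l x u v" and ?m' = "motion_density f t l x' u' v'"
  have m: "?m \<in> L_infty b" "?m' \<in> L_infty b"
    using motion_density_L_infty[OF tb l cont(1) u(1) v(1)]
      motion_density_L_infty[OF tb l cont(2) u(2) v(2)] by auto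
  obtain \<kappa> where "\<kappa> > 0" and gronwall: "\<And>\<theta> \<psi> A m \<tau>. \<lbrakk>\<theta> \<in> {0..T}; continuous_on {0..\<theta>} \<psi>;
      \<And>\<tau>. \<tau> \<in> {0..\<theta>} \<Longrightarrow> 0 \<le> \<psi> \<tau>; 0 \<le> A; m \<in> L_infty \<theta>;
      AE \<xi> in lebesgue_on {0..\<theta>}. norm (m \<xi>) \<le> L * \<psi> \<xi>;
      \<And>\<tau>. \<tau> \<in> {0..\<theta>} \<Longrightarrow> \<psi> \<tau> \<le> A + norm (volterra K \<tau> m); \<tau> \<in> {0..\<theta>}\<rbrakk>
      \<Longrightarrow> \<psi> \<tau> \<le> 2 * A * exp (\<kappa> * \<tau>)"
    by (rule volterra_gronwall[OF L(1)]) blast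
  \<comment> \<open>the Gronwall inequality with additive constant \<open>A = 0\<close>\<close>
  have "norm (x \<tau> - x' \<tau>) \<le> 2 * 0 * exp (\<kappa> * \<tau>)"
  proof (rule gronwall[where \<theta> = b and m = "\<lambda>\<xi>. ?m \<xi> - ?m' \<xi>"])
    show "continuous_on {0..b} (\<lambda>\<tau>. norm (x \<tau> - x' \<tau>))"
      using cont by (intro continuous_intros)
    show "(\<lambda>\<xi>. ?m \<xi> - ?m' \<xi>) \<in> L_infty b"
      using m by (rule L_infty_diff)
    show "AE \<xi> in lebesgue_on {0..b}. norm (?m \<xi> - ?m' \<xi>) \<le> L * norm (x \<xi> - x' \<xi>)"
      using eq unfolding AE_lebesgue_on_interval_iff
    proof eventually_elim
      case (elim \<xi>)
      show ?case
      proof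
        assume \<xi>: "\<xi> \<in> {0..b}"
        show "norm (?m \<xi> - ?m' \<xi>) \<le> L * norm (x \<xi> - x' \<xi>)"
        proof (cases "\<xi> < t")
          case False
          then have "u \<xi> = u' \<xi>" "v \<xi> = v' \<xi>" "u' \<xi> \<in> P" "v' \<xi> \<in> Q"
            using elim \<xi> tb controlsD(2)[OF u(2)] controlsD(2)[OF v(2)] by auto
          then show ?thesis
            using False L(2)[of \<xi> "x \<xi>" "x' \<xi>"] R(2)[OF \<xi>] \<xi> tb by (simp add: motion_density_def)
        qed (use L(1) in \<open>simp add: motion_density_def\<close>)
      qed
    qed
    fix s assume s: "s \<in> {0..b}"
    have "x s - x' s = volterra K s ?m - volterra K s ?m'"
      using x x' s by (auto simp: solves_def)
    also have "\<dots> = volterra K s (\<lambda>\<xi>. ?m \<xi> - ?m' \<xi>)"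
      using s tb m by (intro volterra_diff[symmetric]) (auto intro: L_infty_mono)
    finally show "norm (x s - x' s) \<le> 0 + norm (volterra K s (\<lambda>\<xi>. ?m \<xi> - ?m' \<xi>))"
      by simp
  qed (use tb \<tau> in auto)
  then show ?thesis by simp
qed

lemma solves_exists:
  assumes t: "t \<in> {0..T}" and l: "l \<in> L_infty t"
    and u: "u \<in> controls t T P" and v: "v \<in> controls t T Q"
  obtains x where "x \<in> extensional {0..T}" and "solves y K f T t l u v x"
proof -
  have l0: "(\<lambda>\<xi>. if \<xi> < t then l \<xi> else 0) \<in> L_infty T"
    using l t by (intro L_infty_if_less[where D = 0]) auto
  define g where "g \<tau> = y \<tau> + volterra K \<tau> (\<lambda>\<xi>. if \<xi> < t then l \<xi> else 0)" for \<tau>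
  \<comment> \<open>The density \<open>l\<close> is only essentially bounded; moved into \<open>g\<close>, it leaves a right-hand side with
    linear growth at every time.\<close>
  define F where "F \<xi> z = (if \<xi> < t then 0 else f \<xi> z (u \<xi>) (v \<xi>))" for \<xi> z
  have F_eq: "(\<lambda>\<xi>. F \<xi> (z \<xi>)) = motion_density f t (\<lambda>_. 0) z u v" for z
    by (simp add: F_def motion_density_def fun_eq_iff)
  have F_L: "(\<lambda>\<xi>. F \<xi> (z \<xi>)) \<in> L_infty T" if "continuous_on {0..T} z" for z
    unfolding F_eq using that t u v
    by (intro motion_density_L_infty) (auto intro: continuous_on_imp_L_infty)
  have uv: "u \<xi> \<in> P" "v \<xi> \<in> Q" if "\<xi> \<in> {0..T}" "\<not> \<xi> < t" for \<xi>
    using controlsD(2)[OF u] controlsD(2)[OF v] that by auto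
  obtain c where c: "c > 0" "\<And>\<tau> z p q. \<lbrakk>\<tau> \<in> {0..T}; p \<in> P; q \<in> Q\<rbrakk> \<Longrightarrow> norm (f \<tau> z p q) \<le> c * (1 + norm z)"
    using f_growth by blast
  obtain x where x: "continuous_on {0..T} x"
    "\<And>\<tau>. \<tau> \<in> {0..T} \<Longrightarrow> x \<tau> = g \<tau> + volterra K \<tau> (\<lambda>\<xi>. F \<xi> (x \<xi>))"
  proof (rule volterra_equation_has_solution[of g F c])
    show "continuous_on {0..T} g"
      unfolding g_def using y_cont l0 by (intro continuous_intros continuous_on_volterra)
    show "(\<lambda>\<xi>. F \<xi> (z \<xi>)) \<in> borel_measurable (lebesgue_on {0..T})" if "continuous_on {0..T} z" for z
      using F_L[OF that] by (simp add: L_infty_def)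
    show "norm (F \<xi> z) \<le> c * (1 + norm z)" if "\<xi> \<in> {0..T}" for \<xi> z
      using c uv[OF that] that by (simp add: F_def)
    show "\<exists>L>0. \<forall>\<xi>\<in>{0..T}. \<forall>z\<in>cball 0 R. \<forall>z'\<in>cball 0 R. norm (F \<xi> z - F \<xi> z') \<le> L * norm (z - z')"
      if "R > 0" for R
    proof -
      obtain L where L: "L > 0" "\<And>\<xi> z z' p q. \<lbrakk>\<xi> \<in> {0..T}; z \<in> cball 0 R; z' \<in> cball 0 R; p \<in> P; q \<in> Q\<rbrakk>
          \<Longrightarrow> norm (f \<xi> z p q - f \<xi> z' p q) \<le> L * norm (z - z')"
        by (rule f_lipschitzE[OF \<open>R > 0\<close>]) blast
      have "norm (F \<xi> z - F \<xi> z') \<le> L * norm (z - z')"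
        if "\<xi> \<in> {0..T}" "z \<in> cball 0 R" "z' \<in> cball 0 R" for \<xi> z z'
        using L that uv[OF that(1)] by (cases "\<xi> < t") (auto simp: F_def)
      with L(1) show ?thesis by blast
    qed
  qed (use c in auto)
  define x' where "x' = restrict x {0..T}"
  have cont: "continuous_on {0..T} x'"
    using x(1) unfolding x'_def by (subst continuous_on_cong[where g = x]) auto
  have "x' \<tau> = y \<tau> + volterra K \<tau> (motion_density f t l x' u v)" if \<tau>: "\<tau> \<in> {0..T}" for \<tau>
  proof -
    have md: "motion_density f t l x' u v \<in> L_infty \<tau>"
      using motion_density_L_infty[of t T l x' u v] t l cont u v \<tau> by (auto intro: L_infty_mono)
    have l0\<tau>: "(\<lambda>\<xi>. if \<xi> < t then l \<xi> else 0) \<in> L_infty \<tau>"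
      using l0 \<tau> by (auto intro: L_infty_mono)
    have "volterra K \<tau> (\<lambda>\<xi>. F \<xi> (x \<xi>))
        = volterra K \<tau> (\<lambda>\<xi>. motion_density f t l x' u v \<xi> - (if \<xi> < t then l \<xi> else 0))"
      by (rule volterra_cong) (use \<tau> in \<open>auto simp: F_def motion_density_def x'_def\<close>)
    also have "\<dots> = volterra K \<tau> (motion_density f t l x' u v) - volterra K \<tau> (\<lambda>\<xi>. if \<xi> < t then l \<xi> else 0)"
      using \<tau> md l0\<tau> by (rule volterra_diff)
    finally show ?thesis
      using x(2)[OF \<tau>] \<tau> by (simp add: g_def x'_def)
  qed
  with cont have "solves y K f T t l u v x'" by (simp add: solves_def)
  then show thesis by (rule that[rotated]) (simp add: x'_def)
qed


subsection \<open>Histories\<close>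

lemma generates_gen_density:
  assumes "(t, w) \<in> positions T y K"
  shows "gen_density y K t w \<in> L_infty t"
    and "\<And>\<tau>. \<tau> \<in> {0..t} \<Longrightarrow> w \<tau> = y \<tau> + volterra K \<tau> (gen_density y K t w)"
proof -
  have "gen_density y K t w \<in> L_infty t \<and>
      (\<forall>\<tau>\<in>{0..t}. w \<tau> = y \<tau> + volterra K \<tau> (gen_density y K t w))"
  proof (cases "t = 0")
    case True
    have "(\<lambda>\<xi>. 0 :: real^'n) \<in> L_infty 0"
      by (intro continuous_on_imp_L_infty) auto
    with True assms show ?thesis
      by (auto simp: gen_density_def positions_def histories_def volterra_def set_lebesgue_integral_def)
  next
    case False
    then have "\<exists>l. generates y K t l w"
      using assms by (auto simp: positions_def histories_def)
    then have "generates y K t (SOME l. generates y K t l w) w"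
      by (rule someI_ex)
    then have "generates y K t (gen_density y K t w) w"
      using False by (simp add: gen_density_def)
    then show ?thesis
      unfolding generates_def volterra_def .
  qed
  then show "gen_density y K t w \<in> L_infty t"
    and "\<And>\<tau>. \<tau> \<in> {0..t} \<Longrightarrow> w \<tau> = y \<tau> + volterra K \<tau> (gen_density y K t w)"
    by auto
qed

text \<open>By injectivity of the kernel operator, a density found by any means is the one of the history.\<close>

lemma positionI:
  assumes t: "t \<in> {0..T}" and w: "w \<in> extensional {0..t}" and l: "l \<in> L_infty t"
    and eq: "\<And>\<tau>. \<tau> \<in> {0..t} \<Longrightarrow> w \<tau> = y \<tau> + volterra K \<tau> l"
  shows "(t, w) \<in> positions T y K"
    and "AE \<xi> in lebesgue_on {0..t}. gen_density y K t w \<xi> = l \<xi>"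
proof -
  show pos: "(t, w) \<in> positions T y K"
  proof (cases "t = 0")
    case True
    have "volterra K 0 l = 0"
      unfolding volterra_def using set_integral_cong_except_right_endpoint[of 0 0 _ "\<lambda>_. 0"] by simp
    then show ?thesis
      using True t w eq[of 0] by (auto simp: positions_def histories_def)
  next
    case False
    then have "generates y K t l w"
      using l eq by (auto simp: generates_def volterra_def)
    then show ?thesis
      using False t w by (auto simp: positions_def histories_def)
  qed
  show "AE \<xi> in lebesgue_on {0..t}. gen_density y K t w \<xi> = l \<xi>"
  proof (cases "t = 0")
    case True
    show ?thesis
      unfolding AE_lebesgue_on_interval_iff using AE_lebesgue_neq[of 0]
      by eventually_elim (use True in auto)
  next
    case False
    let ?g = "gen_density y K t w"
    have g: "?g \<in> L_infty t" by (rule generates_gen_density[OF pos])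
    have "volterra K \<tau> (\<lambda>\<xi>. ?g \<xi> - l \<xi>) = 0" if \<tau>: "\<tau> \<in> {0..t}" for \<tau>
    proof -
      have "volterra K \<tau> (\<lambda>\<xi>. ?g \<xi> - l \<xi>) = volterra K \<tau> ?g - volterra K \<tau> l"
        using \<tau> t g l by (intro volterra_diff) (auto intro: L_infty_mono)
      then show ?thesis
        using generates_gen_density(2)[OF pos \<tau>] eq[OF \<tau>] by simp
    qed
    moreover have "(\<lambda>\<xi>. ?g \<xi> - l \<xi>) \<in> L_infty t"
      using g l by (rule L_infty_diff)
    ultimately have "AE \<xi> in lebesgue_on {0..t}. ?g \<xi> - l \<xi> = 0"
      using K_injective[rule_format, of t "\<lambda>\<xi>. ?g \<xi> - l \<xi>"] False t unfolding volterra_def by auto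
    then show ?thesis by simp
  qed
qed


subsection \<open>Existence, uniqueness and the semigroup property\<close>

lemma volterra_motion_density:
  assumes t: "t \<in> {0..T}" and l: "l \<in> L_infty t" and x: "continuous_on {0..T} x"
    and u: "u \<in> controls t T P" and v: "v \<in> controls t T Q"
  shows "\<And>\<tau>. \<tau> \<in> {0..t} \<Longrightarrow> volterra K \<tau> (motion_density f t l x u v) = volterra K \<tau> l"
    and "\<And>\<tau>. \<tau> \<in> {t..T} \<Longrightarrow> volterra K \<tau> (motion_density f t l x u v)
      = (LINT \<xi>:{0..t}|lebesgue. K \<tau> \<xi> *v l \<xi>)
        + (LINT \<xi>:{t..\<tau>}|lebesgue. K \<tau> \<xi> *v f \<xi> (x \<xi>) (u \<xi>) (v \<xi>))"
proof -
  let ?m = "motion_density f t l x u v"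
  show "volterra K \<tau> ?m = volterra K \<tau> l" if "\<tau> \<in> {0..t}" for \<tau>
    unfolding volterra_def
    by (rule set_integral_cong_except_right_endpoint) (use that in \<open>auto simp: motion_density_def\<close>)
  fix \<tau> assume \<tau>: "\<tau> \<in> {t..T}"
  have "?m \<in> L_infty T"
    using t l x u v by (intro motion_density_L_infty) auto
  then have "?m \<in> L_infty \<tau>"
    by (rule L_infty_mono) (use \<tau> in auto)
  then have "set_integrable lebesgue {0..\<tau>} (\<lambda>\<xi>. K \<tau> \<xi> *v ?m \<xi>)"
    unfolding set_integrable_interval_iff using t \<tau> by (intro integrable_K_mult) auto
  then have "volterra K \<tau> ?m
      = (LINT \<xi>:{0..t}|lebesgue. K \<tau> \<xi> *v ?m \<xi>) + (LINT \<xi>:{t..\<tau>}|lebesgue. K \<tau> \<xi> *v ?m \<xi>)"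
    unfolding volterra_def using t \<tau> by (intro set_integral_interval_split) auto
  moreover have "(LINT \<xi>:{0..t}|lebesgue. K \<tau> \<xi> *v ?m \<xi>) = (LINT \<xi>:{0..t}|lebesgue. K \<tau> \<xi> *v l \<xi>)"
    by (rule set_integral_cong_except_right_endpoint) (auto simp: motion_density_def)
  moreover have "(LINT \<xi>:{t..\<tau>}|lebesgue. K \<tau> \<xi> *v ?m \<xi>)
      = (LINT \<xi>:{t..\<tau>}|lebesgue. K \<tau> \<xi> *v f \<xi> (x \<xi>) (u \<xi>) (v \<xi>))"
    by (rule set_lebesgue_integral_cong) (auto simp: motion_density_def)
  ultimately show "volterra K \<tau> ?m = (LINT \<xi>:{0..t}|lebesgue. K \<tau> \<xi> *v l \<xi>)
      + (LINT \<xi>:{t..\<tau>}|lebesgue. K \<tau> \<xi> *v f \<xi> (x \<xi>) (u \<xi>) (v \<xi>))" by simp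
qed

lemma motion_equation_iff_solves:
  assumes pos: "(t, w) \<in> positions T y K" and u: "u \<in> controls t T P" and v: "v \<in> controls t T Q"
  shows "x \<in> mspace (C_space T) \<and> restrict x {0..t} = w \<and>
        (\<forall>\<tau>\<in>{t..T}. x \<tau> = extension y K t w \<tau> +
           (LINT \<xi>:{t..\<tau>}|lebesgue. K \<tau> \<xi> *v f \<xi> (x \<xi>) (u \<xi>) (v \<xi>)))
    \<longleftrightarrow> x \<in> extensional {0..T} \<and> solves y K f T t (gen_density y K t w) u v x"
    (is "?L \<longleftrightarrow> ?R")
proof (cases "x \<in> extensional {0..T} \<and> continuous_on {0..T} x")
  case True
  let ?g = "gen_density y K t w" and ?m = "motion_density f t (gen_density y K t w) x u v"
  have t: "t \<in> {0..T}" and w: "w \<in> extensional {0..t}"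
    using pos by (auto simp: positions_def histories_def split: if_splits)
  note g = generates_gen_density[OF pos]
  note vm = volterra_motion_density[OF t g(1) conjunct2[OF True] u v]
  have "restrict x {0..t} = w \<longleftrightarrow> (\<forall>\<tau>\<in>{0..t}. x \<tau> = y \<tau> + volterra K \<tau> ?m)"
  proof
    assume "restrict x {0..t} = w"
    then have "x \<tau> = w \<tau>" if "\<tau> \<in> {0..t}" for \<tau>
      using that by (metis restrict_apply')
    then show "\<forall>\<tau>\<in>{0..t}. x \<tau> = y \<tau> + volterra K \<tau> ?m"
      using g(2) vm(1) by simp
  next
    assume "\<forall>\<tau>\<in>{0..t}. x \<tau> = y \<tau> + volterra K \<tau> ?m"
    then have "restrict x {0..t} \<tau> = w \<tau>" if "\<tau> \<in> {0..t}" for \<tau>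
      using that g(2) vm(1) by simp
    then show "restrict x {0..t} = w"
      using w by (intro extensionalityI[where A = "{0..t}"]) auto
  qed
  moreover have "extension y K t w \<tau> + (LINT \<xi>:{t..\<tau>}|lebesgue. K \<tau> \<xi> *v f \<xi> (x \<xi>) (u \<xi>) (v \<xi>))
      = y \<tau> + volterra K \<tau> ?m" if "\<tau> \<in> {t..T}" for \<tau>
    using vm(2)[OF that] that by (simp add: extension_def)
  moreover have "{0..T} = {0..t} \<union> {t..T}" using t by auto
  ultimately show ?thesis
    using True by (auto simp: mspace_C_space solves_def)
qed (auto simp: mspace_C_space solves_def)

lemma motion_solves:
  assumes pos: "(t, w) \<in> positions T y K" and u: "u \<in> controls t T P" and v: "v \<in> controls t T Q"
  shows "motion T y K f t w u v \<in> extensional {0..T}"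
    and "solves y K f T t (gen_density y K t w) u v (motion T y K f t w u v)"
    and "\<And>x. \<lbrakk>x \<in> extensional {0..T}; solves y K f T t (gen_density y K t w) u v x\<rbrakk>
      \<Longrightarrow> motion T y K f t w u v = x"
proof -
  let ?S = "\<lambda>x. x \<in> extensional {0..T} \<and> solves y K f T t (gen_density y K t w) u v x"
  have t: "t \<in> {0..T}" using pos by (auto simp: positions_def)
  have uniq: "x = x'" if "?S x" "?S x'" for x x'
  proof (rule extensionalityI[where A = "{0..T}"])
    fix \<tau> assume "\<tau> \<in> {0..T}"
    then show "x \<tau> = x' \<tau>"
      using solves_unique[OF _ _ _ generates_gen_density(1)[OF pos] u u v v] that t by auto
  qed (use that in auto)
  obtain x where x: "?S x"
    using solves_exists[OF t generates_gen_density(1)[OF pos] u v] by blast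
  have m: "motion T y K f t w u v = (THE x. ?S x)"
    unfolding motion_def motion_equation_iff_solves[OF assms] ..
  have *: "motion T y K f t w u v = x'" if "?S x'" for x'
    unfolding m using that uniq by (intro the_equality) blast+
  show "\<And>x. \<lbrakk>x \<in> extensional {0..T}; solves y K f T t (gen_density y K t w) u v x\<rbrakk>
      \<Longrightarrow> motion T y K f t w u v = x"
    using * by blast
  show "motion T y K f t w u v \<in> extensional {0..T}"
    "solves y K f T t (gen_density y K t w) u v (motion T y K f t w u v)"
    using *[OF x] x by auto
qed

lemma motion_continuous:
  assumes "(t, w) \<in> positions T y K" and "u \<in> controls t T P" and "v \<in> controls t T Q"
  shows "continuous_on {0..T} (motion T y K f t w u v)"
  using motion_solves(2)[OF assms] by (simp add: solves_def)

lemma motion_AE_cong: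
  assumes pos: "(t, w) \<in> positions T y K" and \<theta>: "\<theta> \<in> {t..T}"
    and u: "u \<in> controls t T P" "u' \<in> controls t T P" and v: "v \<in> controls t T Q" "v' \<in> controls t T Q"
    and eq: "AE \<xi> in lebesgue_on {t..\<theta>}. u \<xi> = u' \<xi>" "AE \<xi> in lebesgue_on {t..\<theta>}. v \<xi> = v' \<xi>"
  shows "\<tau> \<in> {0..\<theta>} \<Longrightarrow> motion T y K f t w u v \<tau> = motion T y K f t w u' v' \<tau>"
proof -
  have t: "t \<in> {0..T}" using pos by (auto simp: positions_def)
  have mono: "solves y K f \<theta> t l p q x" if "solves y K f T t l p q x" for l p q x
    using that \<theta> unfolding solves_def by (auto elim: continuous_on_subset)
  show "\<tau> \<in> {0..\<theta>} \<Longrightarrow> motion T y K f t w u v \<tau> = motion T y K f t w u' v' \<tau>"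
    by (rule solves_unique[OF _ _ _ generates_gen_density(1)[OF pos] u v eq
          mono[OF motion_solves(2)[OF pos u(1) v(1)]] mono[OF motion_solves(2)[OF pos u(2) v(2)]]])
       (use t \<theta> in auto)
qed

text \<open>
  The part of a motion up to \<open>\<theta>\<close> is generated by the density that generates the motion; hence
  continuing from that history by the same controls reproduces the motion.
\<close>

lemma motion_semigroup:
  assumes pos: "(t, w) \<in> positions T y K" and \<theta>: "\<theta> \<in> {t..T}"
    and u: "u \<in> controls t T P" and v: "v \<in> controls t T Q"
  defines "x \<equiv> motion T y K f t w u v"
  shows "(\<theta>, restrict x {0..\<theta>}) \<in> positions T y K"
    and "motion T y K f \<theta> (restrict x {0..\<theta>}) (restrict u {\<theta>..T}) (restrict v {\<theta>..T}) = x"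
proof -
  let ?w = "restrict x {0..\<theta>}" and ?m = "motion_density f t (gen_density y K t w) x u v"
  let ?u = "restrict u {\<theta>..T}" and ?v = "restrict v {\<theta>..T}"
  let ?m' = "motion_density f \<theta> (gen_density y K \<theta> ?w) x ?u ?v"
  have t: "t \<in> {0..T}" and \<theta>T: "\<theta> \<in> {0..T}" using pos \<theta> by (auto simp: positions_def)
  have x: "continuous_on {0..T} x" "x \<in> extensional {0..T}"
    "\<And>\<tau>. \<tau> \<in> {0..T} \<Longrightarrow> x \<tau> = y \<tau> + volterra K \<tau> ?m"
    using motion_solves(1,2)[OF pos u v] by (auto simp: x_def solves_def)
  have m: "?m \<in> L_infty T"
    using t x u v generates_gen_density(1)[OF pos] by (intro motion_density_L_infty) auto
  have m\<theta>: "?m \<in> L_infty \<theta>"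
    by (rule L_infty_mono[OF m]) (use \<theta> in auto)
  have eq\<theta>: "?w \<tau> = y \<tau> + volterra K \<tau> ?m" if "\<tau> \<in> {0..\<theta>}" for \<tau>
    using x(3)[of \<tau>] that \<theta> by auto
  have w: "(\<theta>, ?w) \<in> positions T y K" "AE \<xi> in lebesgue_on {0..\<theta>}. gen_density y K \<theta> ?w \<xi> = ?m \<xi>"
    by (rule positionI[OF \<theta>T restrict_extensional m\<theta> eq\<theta>]; assumption)+
  from w(1) show pos\<theta>: "(\<theta>, ?w) \<in> positions T y K" .
  have uv: "?u \<in> controls \<theta> T P" "?v \<in> controls \<theta> T Q"
    using u v \<theta> by (auto intro: restrict_controls)
  have m': "?m' \<in> L_infty T"
    using \<theta>T x uv generates_gen_density(1)[OF pos\<theta>] by (intro motion_density_L_infty) auto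
  have "AE \<xi> in lebesgue_on {0..T}. ?m' \<xi> = ?m \<xi>"
    using w(2) unfolding AE_lebesgue_on_interval_iff
    by eventually_elim (use \<theta> in \<open>auto simp: motion_density_def\<close>)
  then have AE_eq: "AE \<xi> in lebesgue_on {0..\<tau>}. ?m' \<xi> = ?m \<xi>" if "\<tau> \<in> {0..T}" for \<tau>
    by (rule AE_lebesgue_on_subinterval) (use that in auto)
  have "volterra K \<tau> ?m' = volterra K \<tau> ?m" if "\<tau> \<in> {0..T}" for \<tau>
    using that L_infty_mono[OF m] L_infty_mono[OF m'] AE_eq[OF that] by (intro volterra_cong_AE) auto
  then have "solves y K f T \<theta> (gen_density y K \<theta> ?w) ?u ?v x"
    using x by (auto simp: solves_def)
  then show "motion T y K f \<theta> ?w ?u ?v = x"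
    using motion_solves(3)[OF pos\<theta> uv] x(2) by blast
qed


section \<open>Dynamic programming for the lower value\<close>

lemma cost_split:
  assumes chi: "continuous_on ({0..T} \<times> UNIV \<times> P \<times> Q) (\<lambda>(\<tau>, x, u, v). chi \<tau> x u v)"
    and pos: "(t, w) \<in> positions T y K" and \<theta>: "\<theta> \<in> {t..T}"
    and u: "u \<in> controls t T P" and v: "v \<in> controls t T Q"
  defines "x \<equiv> motion T y K f t w u v"
  shows "cost T y K f chi \<sigma> t w u v
    = cost T y K f chi \<sigma> \<theta> (restrict x {0..\<theta>}) (restrict u {\<theta>..T}) (restrict v {\<theta>..T})
      + (LINT \<tau>:{t..\<theta>}|lebesgue. chi \<tau> (x \<tau>) (u \<tau>) (v \<tau>))"
proof -
  let ?c = "\<lambda>\<tau>. chi \<tau> (x \<tau>) (u \<tau>) (v \<tau>)"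
  have t: "t \<in> {0..T}" using pos by (auto simp: positions_def)
  have x: "continuous_on {t..T} x"
    using motion_continuous[OF pos u v] unfolding x_def by (rule continuous_on_subset) (use t in auto)
  have "set_integrable lebesgue {t..T} ?c"
    using t x u v by (intro set_integrable_along_controls[OF chi]) auto
  then have "(LINT \<tau>:{t..T}|lebesgue. ?c \<tau>) = (LINT \<tau>:{t..\<theta>}|lebesgue. ?c \<tau>) + (LINT \<tau>:{\<theta>..T}|lebesgue. ?c \<tau>)"
    using \<theta> by (intro set_integral_interval_split) auto
  moreover have "(LINT \<tau>:{\<theta>..T}|lebesgue. chi \<tau> (x \<tau>) (restrict u {\<theta>..T} \<tau>) (restrict v {\<theta>..T} \<tau>))
      = (LINT \<tau>:{\<theta>..T}|lebesgue. ?c \<tau>)"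
    by (rule set_lebesgue_integral_cong) auto
  ultimately show ?thesis
    using motion_semigroup(2)[OF pos \<theta> u v] by (simp add: cost_def Let_def x_def[symmetric])
qed

lemma running_cost_AE_cong:
  fixes chi :: "real \<Rightarrow> real^'n \<Rightarrow> real^'p \<Rightarrow> real^'q \<Rightarrow> real"
  assumes chi: "continuous_on ({0..T} \<times> UNIV \<times> P \<times> Q) (\<lambda>(\<tau>, x, u, v). chi \<tau> x u v)"
    and pos: "(t, w) \<in> positions T y K" and \<theta>: "\<theta> \<in> {t..T}"
    and u: "u \<in> controls t T P" "u' \<in> controls t T P" and v: "v \<in> controls t T Q" "v' \<in> controls t T Q"
    and eq: "AE \<xi> in lebesgue_on {t..\<theta>}. u \<xi> = u' \<xi>" "AE \<xi> in lebesgue_on {t..\<theta>}. v \<xi> = v' \<xi>"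
  shows "(LINT \<tau>:{t..\<theta>}|lebesgue. chi \<tau> (motion T y K f t w u v \<tau>) (u \<tau>) (v \<tau>))
    = (LINT \<tau>:{t..\<theta>}|lebesgue. chi \<tau> (motion T y K f t w u' v' \<tau>) (u' \<tau>) (v' \<tau>))"
proof -
  let ?x = "motion T y K f t w u v" and ?x' = "motion T y K f t w u' v'"
  have t: "t \<in> {0..T}" using pos by (auto simp: positions_def)
  have x: "continuous_on {t..\<theta>} ?x" "continuous_on {t..\<theta>} ?x'"
    using motion_continuous[OF pos u(1) v(1)] motion_continuous[OF pos u(2) v(2)] t \<theta>
    by (auto elim!: continuous_on_subset)
  have AE: "AE \<tau> in lebesgue_on {t..\<theta>}. chi \<tau> (?x \<tau>) (u \<tau>) (v \<tau>) = chi \<tau> (?x' \<tau>) (u' \<tau>) (v' \<tau>)"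
    using eq AE_space
  proof eventually_elim
    case (elim \<tau>)
    then show ?case
      using motion_AE_cong[OF pos \<theta> u v eq, of \<tau>] t by auto
  qed
  show ?thesis
    unfolding set_integral_eq_lebesgue_on
    using AE t \<theta> x u v
    by (intro integral_cong_AE borel_measurable_along_controls[OF chi]) auto
qed

lemma restrict_motion_AE_cong:
  assumes "(t, w) \<in> positions T y K" "\<theta> \<in> {t..T}"
    and "u \<in> controls t T P" "u' \<in> controls t T P" and "v \<in> controls t T Q" "v' \<in> controls t T Q"
    and "AE \<xi> in lebesgue_on {t..\<theta>}. u \<xi> = u' \<xi>" "AE \<xi> in lebesgue_on {t..\<theta>}. v \<xi> = v' \<xi>"
  shows "restrict (motion T y K f t w u v) {0..\<theta>} = restrict (motion T y K f t w u' v') {0..\<theta>}"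
  by (rule restrict_ext) (rule motion_AE_cong[OF assms])

theorem lower_value_dynamic_programming:
  assumes chi: "continuous_on ({0..T} \<times> UNIV \<times> P \<times> Q) (\<lambda>(\<tau>, x, u, v). chi \<tau> x u v)"
    and pos: "(t, w) \<in> positions T y K" and \<theta>: "\<theta> \<in> {t..T}"
  shows "lower_value T P Q y K f chi \<sigma> t w =
    (INF a\<in>strategies t T Q P. SUP v\<in>controls t T Q.
      let x = motion T y K f t w (a v) v
      in lower_value T P Q y K f chi \<sigma> \<theta> (restrict x {0..\<theta>}) +
         ereal (LINT \<tau>:{t..\<theta>}|lebesgue. chi \<tau> (x \<tau>) (a v \<tau>) (v \<tau>)))"
proof -
  define hist where "hist u v = restrict (motion T y K f t w u v) {0..\<theta>}" for u v
  define run where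
    "run u v = (LINT \<tau>:{t..\<theta>}|lebesgue. chi \<tau> (motion T y K f t w u v \<tau>) (u \<tau>) (v \<tau>))" for u v
  let ?low = "lower_value T P Q y K f chi \<sigma>" and ?cost = "cost T y K f chi \<sigma>"
  let ?rhs = "INF a\<in>strategies t T Q P. SUP v\<in>controls t T Q. ?low \<theta> (hist (a v) v) + ereal (run (a v) v)"
  have cong: "hist u v = hist u' v' \<and> run u v = run u' v'"
    if "u \<in> controls t T P" "u' \<in> controls t T P" "v \<in> controls t T Q" "v' \<in> controls t T Q"
      "AE \<xi> in lebesgue_on {t..\<theta>}. u \<xi> = u' \<xi>" "AE \<xi> in lebesgue_on {t..\<theta>}. v \<xi> = v' \<xi>" for u u' v v'
    unfolding hist_def run_def
    using restrict_motion_AE_cong[OF pos \<theta> that] running_cost_AE_cong[OF chi pos \<theta> that] by blast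
  have split: "?cost t w u v = ?cost \<theta> (hist u v) (restrict u {\<theta>..T}) (restrict v {\<theta>..T}) + run u v"
    if "u \<in> controls t T P" "v \<in> controls t T Q" for u v
    unfolding hist_def run_def by (rule cost_split[OF chi pos \<theta> that])
  have "?low t w \<le> ?rhs"
  proof (rule INF_greatest, rule dense_ge)
    fix a r
    assume a: "a \<in> strategies t T Q P"
      and r: "(SUP v\<in>controls t T Q. ?low \<theta> (hist (a v) v) + ereal (run (a v) v)) < r"
    note aD = strategiesD[OF a]
    show "?low t w \<le> r"
    proof (cases r)
      case (real r')
      \<comment> \<open>As the values are extended reals, a real level \<open>r'\<close> above the supremum replaces the usual
        \<open>\<epsilon>\<close>: the continuation has to keep the total cost below \<open>r'\<close>. It depends on the past only through
        the history and the accrued cost.\<close>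
      define good where "good p c b \<longleftrightarrow> b \<in> strategies \<theta> T Q P \<and>
        (SUP v\<in>controls \<theta> T Q. ereal (?cost \<theta> p (b v) v)) < ereal (r' - c)" for p c b
      define A where "A v = (SOME b. good (hist (a v) v) (run (a v) v) b)" for v
      have A: "good (hist (a v) v) (run (a v) v) (A v)" if "v \<in> controls t T Q" for v
      proof -
        have "?low \<theta> (hist (a v) v) + ereal (run (a v) v)
            \<le> (SUP v\<in>controls t T Q. ?low \<theta> (hist (a v) v) + ereal (run (a v) v))"
          by (rule SUP_upper[OF that])
        also have "\<dots> < ereal r'" using r real by simp
        finally have "?low \<theta> (hist (a v) v) < ereal (r' - run (a v) v)"
          using ereal_less_minus[of "ereal (run (a v) v)" "?low \<theta> (hist (a v) v)" "ereal r'"] by simp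
        then have "\<exists>b. good (hist (a v) v) (run (a v) v) b"
          unfolding lower_value_def[of _ _ _ _ _ _ _ _ \<theta>] INF_less_iff good_def by blast
        then show ?thesis unfolding A_def by (rule someI_ex)
      qed
      let ?b = "\<lambda>v\<in>controls t T Q. concat_controls t \<theta> T (a v) (A v (restrict v {\<theta>..T}))"
      have A_cong: "A v = A v'" if "v \<in> controls t T Q" "v' \<in> controls t T Q"
        and "AE \<tau> in lebesgue_on {t..\<theta>}. v \<tau> = v' \<tau>" for v v'
        unfolding A_def using cong[of "a v" "a v'" v v'] aD(1) aD(2)[OF \<theta>] that by simp
      have A_strat: "A v \<in> strategies \<theta> T Q P" if "v \<in> controls t T Q" for v
        using A[OF that] by (simp add: good_def)
      have b: "?b \<in> strategies t T Q P"
        by (rule continued_strategy[OF a \<theta>]) (erule A_strat A_cong; assumption)+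
      have "?cost t w (?b v) v \<le> r'" if v: "v \<in> controls t T Q" for v
      proof -
        let ?v = "restrict v {\<theta>..T}"
        have rv: "?v \<in> controls \<theta> T Q"
          using v \<theta> by (intro restrict_controls) auto
        have Av: "A v ?v \<in> controls \<theta> T P"
          using A_strat[OF v] rv by (rule strategiesD)
        have bv: "?b v \<in> controls t T P"
          using b v by (rule strategiesD)
        have "hist (?b v) v = hist (a v) v \<and> run (?b v) v = run (a v) v"
          using bv aD(1)[OF v] v concat_controls_AE_eq[OF \<theta>, of "a v" "A v ?v"] by (intro cong) auto
        moreover have "restrict (?b v) {\<theta>..T} = A v ?v"
          using v restrict_concat_controls[OF Av \<theta>] by simp
        ultimately have "?cost t w (?b v) v = ?cost \<theta> (hist (a v) v) (A v ?v) ?v + run (a v) v"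
          using split[OF bv v] by simp
        moreover have "ereal (?cost \<theta> (hist (a v) v) (A v ?v) ?v)
            \<le> (SUP v'\<in>controls \<theta> T Q. ereal (?cost \<theta> (hist (a v) v) (A v v') v'))"
          by (rule SUP_upper[OF rv])
        then have "ereal (?cost \<theta> (hist (a v) v) (A v ?v) ?v) < ereal (r' - run (a v) v)"
          by (rule le_less_trans) (use A[OF v] in \<open>simp add: good_def\<close>)
        ultimately show ?thesis by simp
      qed
      then have "(SUP v\<in>controls t T Q. ereal (?cost t w (?b v) v)) \<le> r"
        unfolding real by (intro SUP_least) (simp only: ereal_less_eq)
      then show ?thesis
        unfolding lower_value_def by (rule INF_lower2[OF b])
    qed (use r in auto)
  qed
  moreover have "?rhs \<le> ?low t w"
    unfolding lower_value_def[of _ _ _ _ _ _ _ _ t]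
  proof (rule INF_greatest)
    fix a assume a: "a \<in> strategies t T Q P"
    note aD = strategiesD[OF a]
    let ?S = "SUP v\<in>controls t T Q. ereal (?cost t w (a v) v)"
    have "(SUP v\<in>controls t T Q. ?low \<theta> (hist (a v) v) + ereal (run (a v) v)) \<le> ?S"
    proof (rule SUP_least)
      fix v assume v: "v \<in> controls t T Q"
      let ?b = "\<lambda>v'\<in>controls \<theta> T Q. restrict (a (concat_controls t \<theta> T v v')) {\<theta>..T}"
      have "ereal (?cost \<theta> (hist (a v) v) (?b v') v') \<le> ?S - ereal (run (a v) v)"
        if v': "v' \<in> controls \<theta> T Q" for v'
      proof -
        let ?V = "concat_controls t \<theta> T v v'"
        have V: "?V \<in> controls t T Q" using v v' \<theta> by (rule concat_controls_in_controls)
        have "AE \<tau> in lebesgue_on {t..\<theta>}. ?V \<tau> = v \<tau>" by (rule concat_controls_AE_eq[OF \<theta>])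
        then have "hist (a ?V) ?V = hist (a v) v \<and> run (a ?V) ?V = run (a v) v"
          using aD(1) V v \<theta> by (intro cong aD(2)) auto
        then have "?cost t w (a ?V) ?V = ?cost \<theta> (hist (a v) v) (?b v') v' + run (a v) v"
          using split[OF aD(1)[OF V] V] restrict_concat_controls[OF v' \<theta>, of v] v' by simp
        then have "ereal (?cost \<theta> (hist (a v) v) (?b v') v') + ereal (run (a v) v) = ereal (?cost t w (a ?V) ?V)"
          by simp
        also have "\<dots> \<le> ?S" by (rule SUP_upper[OF V])
        finally show ?thesis by (subst ereal_le_minus) auto
      qed
      then have "(SUP v'\<in>controls \<theta> T Q. ereal (?cost \<theta> (hist (a v) v) (?b v') v')) \<le> ?S - ereal (run (a v) v)"
        by (rule SUP_least)
      then have "?low \<theta> (hist (a v) v) \<le> ?S - ereal (run (a v) v)"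
        unfolding lower_value_def[of _ _ _ _ _ _ _ _ \<theta>] by (rule INF_lower2[OF tail_strategy[OF a v \<theta>]])
      then show "?low \<theta> (hist (a v) v) + ereal (run (a v) v) \<le> ?S"
        by (subst (asm) ereal_le_minus) auto
    qed
    then show "?rhs \<le> ?S" by (rule INF_lower2[OF a])
  qed
  ultimately have "?low t w = ?rhs" by (rule antisym)
  then show ?thesis by (simp add: hist_def run_def Let_def)
qed

end

section \<open>Duality between the values\<close>

text \<open>Exchanging the players and changing the sign of the cost exchanges the two values.\<close>

lemma motion_swap:
  "motion T y K (\<lambda>\<tau> x v u. f \<tau> x u v) t w v u = motion T y K f t w u v"
  by (simp add: motion_def)

lemma cost_swap:
  "cost T y K (\<lambda>\<tau> x v u. f \<tau> x u v) (\<lambda>\<tau> x v u. - chi \<tau> x u v) (\<lambda>x. - \<sigma> x) t w v u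
    = - cost T y K f chi \<sigma> t w u v"
  by (simp add: cost_def motion_swap[of T y K f] Let_def set_lebesgue_integral_def)

lemma upper_value_eq_uminus_lower_value:
  "upper_value T P Q y K f chi \<sigma> t w
    = - lower_value T Q P y K (\<lambda>\<tau> x v u. f \<tau> x u v) (\<lambda>\<tau> x v u. - chi \<tau> x u v) (\<lambda>x. - \<sigma> x) t w"
  unfolding upper_value_def lower_value_def cost_swap[of T y K f chi \<sigma>]
    uminus_ereal.simps(1)[symmetric] ereal_SUP_uminus_eq ereal_INF_uminus_eq
  by simp

lemma continuous_on_swap_controls:
  assumes "continuous_on ({0..T} \<times> UNIV \<times> P \<times> Q) (\<lambda>(\<tau>, x, u, v). h \<tau> x u v)"
  shows "continuous_on ({0..T} \<times> UNIV \<times> Q \<times> P) (\<lambda>(\<tau>, x, v, u). h \<tau> x u v)"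
proof -
  have "continuous_on ({0..T} \<times> UNIV \<times> Q \<times> P) (\<lambda>p. (\<lambda>(\<tau>, x, u, v). h \<tau> x u v)
      ((\<lambda>(\<tau>, x, v, u). (\<tau>, x, u, v)) p))"
    by (rule continuous_on_compose2[OF assms])
       (auto simp: split_beta intro!: continuous_intros)
  then show ?thesis by (simp add: split_beta)
qed

theorem upper_value_dynamic_programming:
  assumes sys: "controlled_volterra_system T \<alpha> K Kstar P Q y f"
    and chi: "continuous_on ({0..T} \<times> UNIV \<times> P \<times> Q) (\<lambda>(\<tau>, x, u, v). chi \<tau> x u v)"
    and pos: "(t, w) \<in> positions T y K" and \<theta>: "\<theta> \<in> {t..T}"
  shows "upper_value T P Q y K f chi \<sigma> t w =
    (SUP b\<in>strategies t T P Q. INF u\<in>controls t T P.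
      let x = motion T y K f t w u (b u)
      in upper_value T P Q y K f chi \<sigma> \<theta> (restrict x {0..\<theta>}) +
         ereal (LINT \<tau>:{t..\<theta>}|lebesgue. chi \<tau> (x \<tau>) (u \<tau>) (b u \<tau>)))"
proof -
  interpret controlled_volterra_system T \<alpha> K Kstar P Q y f by (rule sys)
  interpret swap: controlled_volterra_system T \<alpha> K Kstar Q P y "\<lambda>\<tau> x v u. f \<tau> x u v"
  proof (unfold_locales)
    show "\<forall>R>0. \<exists>L>0. \<forall>\<tau>\<in>{0..T}. \<forall>x\<in>cball 0 R. \<forall>x'\<in>cball 0 R. \<forall>v\<in>Q. \<forall>u\<in>P.
        norm (f \<tau> x u v - f \<tau> x' u v) \<le> L * norm (x - x')"
      using f_lipschitz by meson
    show "\<exists>c>0. \<forall>\<tau>\<in>{0..T}. \<forall>x. \<forall>v\<in>Q. \<forall>u\<in>P. norm (f \<tau> x u v) \<le> c * (1 + norm x)"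
      using f_growth by meson
  qed (use P_compact Q_compact y_cont continuous_on_swap_controls[OF f_cont] K_injective in auto)
  have "continuous_on ({0..T} \<times> UNIV \<times> Q \<times> P) (\<lambda>p. - (\<lambda>(\<tau>, x, v, u). chi \<tau> x u v) p)"
    using continuous_on_swap_controls[OF chi] by (rule continuous_on_minus)
  then have chi': "continuous_on ({0..T} \<times> UNIV \<times> Q \<times> P) (\<lambda>(\<tau>, x, v, u). - chi \<tau> x u v)"
    by (simp add: split_beta)
  let ?low = "lower_value T Q P y K (\<lambda>\<tau> x v u. f \<tau> x u v) (\<lambda>\<tau> x v u. - chi \<tau> x u v) (\<lambda>x. - \<sigma> x)"
  let ?up = "upper_value T P Q y K f chi \<sigma>"
  have neg: "- a + ereal (- c) = - (a + ereal c)" for a c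
    by (cases a) auto
  have body: "?low \<theta> (restrict (motion T y K f t w u v) {0..\<theta>}) +
        ereal (LINT \<tau>:{t..\<theta>}|lebesgue. - chi \<tau> (motion T y K f t w u v \<tau>) (u \<tau>) (v \<tau>))
      = - (?up \<theta> (restrict (motion T y K f t w u v) {0..\<theta>}) +
        ereal (LINT \<tau>:{t..\<theta>}|lebesgue. chi \<tau> (motion T y K f t w u v \<tau>) (u \<tau>) (v \<tau>)))" for u v
    unfolding upper_value_eq_uminus_lower_value[of T P Q y K f chi \<sigma>] neg[symmetric]
    by (simp add: set_lebesgue_integral_def)
  show ?thesis
    unfolding upper_value_eq_uminus_lower_value[of T P Q y K f chi \<sigma> t w]
      swap.lower_value_dynamic_programming[OF chi' pos \<theta>]
      Let_def motion_swap[of T y K f] body ereal_SUP_uminus_eq ereal_INF_uminus_eq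
    by simp
qed

theorem proposition5p2:
  fixes T :: real
    and P :: "(real^'p) set" and Q :: "(real^'q) set"
    and y :: "real \<Rightarrow> real^'n"
    and f :: "real \<Rightarrow> real^'n \<Rightarrow> real^'p \<Rightarrow> real^'q \<Rightarrow> real^'n"
    and K Kstar :: "real \<Rightarrow> real \<Rightarrow> real^'n^'n" and \<alpha> :: real
    and chi :: "real \<Rightarrow> real^'n \<Rightarrow> real^'p \<Rightarrow> real^'q \<Rightarrow> real"
    and \<sigma> :: "(real \<Rightarrow> real^'n) \<Rightarrow> real"
    and t \<theta> :: real and w :: "real \<Rightarrow> real^'n"
  assumes T_pos: "T > 0"
    and P: "compact P" "P \<noteq> {}"
    and Q: "compact Q" "Q \<noteq> {}"
    and y_cont: "continuous_on {0..T} y"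
    and f_cont: "continuous_on ({0..T} \<times> UNIV \<times> P \<times> Q) (\<lambda>(\<tau>, x, u, v). f \<tau> x u v)"
    and f_lipschitz: "\<forall>R>0. \<exists>L>0. \<forall>\<tau>\<in>{0..T}. \<forall>x\<in>cball 0 R. \<forall>x'\<in>cball 0 R. \<forall>u\<in>P. \<forall>v\<in>Q.
           norm (f \<tau> x u v - f \<tau> x' u v) \<le> L * norm (x - x')"
    and f_growth: "\<exists>c>0. \<forall>\<tau>\<in>{0..T}. \<forall>x. \<forall>u\<in>P. \<forall>v\<in>Q. norm (f \<tau> x u v) \<le> c * (1 + norm x)"
    and \<alpha>: "0 < \<alpha>" "\<alpha> < 1"
    and K_eq: "\<forall>(\<tau>, \<xi>)\<in>Omega_open T. K \<tau> \<xi> = (1 / (\<tau> - \<xi>) powr (1 - \<alpha>)) *\<^sub>R Kstar \<tau> \<xi>"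
    and Kstar_cont: "continuous_on (Omega T) (\<lambda>(\<tau>, \<xi>). Kstar \<tau> \<xi>)"
    and Kstar_holder: "\<exists>\<beta>. 0 < \<beta> \<and> \<beta> \<le> 1 \<and> (\<exists>L>0. \<forall>\<tau> \<xi> \<xi>'. (\<tau>, \<xi>) \<in> Omega T \<longrightarrow> (\<tau>, \<xi>') \<in> Omega T \<longrightarrow>
           mat_norm (Kstar \<tau> \<xi> - Kstar \<tau> \<xi>') \<le> L * \<bar>\<xi> - \<xi>'\<bar> powr \<beta>)"
    and K_injective: "\<forall>s\<in>{0<..T}. \<forall>l\<in>L_infty s.
           (\<forall>\<tau>\<in>{0..s}. (LINT \<xi>:{0..\<tau>}|lebesgue. K \<tau> \<xi> *v l \<xi>) = 0) \<longrightarrow>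
           (AE \<xi> in lebesgue_on {0..s}. l \<xi> = 0)"
    and chi_cont: "continuous_on ({0..T} \<times> UNIV \<times> P \<times> Q) (\<lambda>(\<tau>, x, u, v). chi \<tau> x u v)"
    and chi_lipschitz: "\<forall>R>0. \<exists>L>0. \<forall>\<tau>\<in>{0..T}. \<forall>x\<in>cball 0 R. \<forall>x'\<in>cball 0 R. \<forall>u\<in>P. \<forall>v\<in>Q.
           \<bar>chi \<tau> x u v - chi \<tau> x' u v\<bar> \<le> L * norm (x - x')"
    and sigma_lipschitz: "\<forall>D. compactin (mtopology_of (C_space T)) D \<longrightarrow>
           (\<exists>L>0. \<forall>x\<in>D. \<forall>x'\<in>D. \<bar>\<sigma> x - \<sigma> x'\<bar> \<le>
              L * (norm (x T - x' T) + (LINT \<tau>:{0..T}|lebesgue. norm (x \<tau> - x' \<tau>))))"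
    and position: "(t, w) \<in> positions T y K"
    and \<theta>: "\<theta> \<in> {t..T}"
  shows "lower_value T P Q y K f chi \<sigma> t w =
           (INF a\<in>strategies t T Q P. SUP v\<in>controls t T Q.
              let x = motion T y K f t w (a v) v
              in lower_value T P Q y K f chi \<sigma> \<theta> (restrict x {0..\<theta>}) +
                 ereal (LINT \<tau>:{t..\<theta>}|lebesgue. chi \<tau> (x \<tau>) (a v \<tau>) (v \<tau>)))
       \<and> upper_value T P Q y K f chi \<sigma> t w =
           (SUP b\<in>strategies t T P Q. INF u\<in>controls t T P.
              let x = motion T y K f t w u (b u)
              in upper_value T P Q y K f chi \<sigma> \<theta> (restrict x {0..\<theta>}) +
                 ereal (LINT \<tau>:{t..\<theta>}|lebesgue. chi \<tau> (x \<tau>) (u \<tau>) (b u \<tau>)))"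
proof -
  have sys: "controlled_volterra_system T \<alpha> K Kstar P Q y f"
    by (unfold_locales; fact)
  show ?thesis
    by (intro conjI controlled_volterra_system.lower_value_dynamic_programming[OF sys chi_cont position \<theta>]
        upper_value_dynamic_programming[OF sys chi_cont position \<theta>])
qed

end
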